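(* Let $\Xi$ be a Polish space, $Q\in\mathcal P(\Xi)$, and $\boldsymbol\epsilon=(\epsilon_1,\ldots,\epsilon_n)$ with $\epsilon_k>0$. Let $h:\Xi\to\mathbb R$ be upper semicontinuous with $h\in L^1(Q)$. Let $c_k:\Xi\times\Xi\to\mathbb R_{\ge0}$, $k\in[n]$, be lower semicontinuous with $c_k(\zeta,\zeta)=0$ for all $\zeta\in\Xi$, and assume: (i) for each $k\in[n]$ there is a nondecreasing sequence $c_{k,m}:\Xi\times\Xi\to\mathbb R_{\ge0}$, $m\in\mathbb N$, of continuous functions with $c_{k,m}(\zeta,\zeta)=0$ for all $\zeta$ and $c_{k,m}(\zeta,\xi)\nearrow c_k(\zeta,\xi)$ for all $\zeta,\xi$; (ii) there exists a compact set $\Xi_{\rm cmp}\subset\Xi$ such that for each $m$ the functions $c_{1,m},\ldots,c_{n,m}$ (restricted to $\Xi_{\rm cmp}\times\Xi_{\rm cmp}$) are linearly independent in $C(\Xi_{\rm cmp}\times\Xi_{\rm cmp})$ and $\mathrm{span}\{c_{1,m},\ldots,c_{n,m}\}\cap C_{{\rm const},2}(\Xi_{\rm cmp}\times\Xi_{\rm cmp})=\{0\}$. Let $\mathcal I^\star$ be the value of the primal problem $\sup_{P\in\mathcal T(Q,\boldsymbol\epsilon)}\mathbb E_P[h(\xi)]$ and $\mathcal J_\star$ the value of the dual problem, as defined in the context. Then $$\mathcal I^\star=\mathcal J_\star=\inf_{\boldsymbol\lambda\succeq0}\Big\{\langle\boldsymbol\lambda,\boldsymbol\epsilon\rangle+\int_\Xi\sup_{\xi\in\Xi}\{h(\xi)-\langle\boldsymbol\lambda,\boldsymbol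 c(\zeta,\xi)\rangle\}\,dQ(\zeta)\Big\},$$ and there exists $(\boldsymbol\lambda,\varphi_{\boldsymbol\lambda})\in\Lambda$, with $\varphi_{\boldsymbol\lambda}(\zeta):=\sup_{\xi\in\Xi}\{h(\xi)-\langle\boldsymbol\lambda,\boldsymbol c(\zeta,\xi)\rangle\}$, $\zeta\in\Xi$, for which the infimum defining $\mathcal J_\star$ is attained.
   Context: $[n]=\{1,\ldots,n\}$; $\boldsymbol c=(c_1,\ldots,c_n)$; $\boldsymbol\lambda\succeq0$ means $\boldsymbol\lambda\in\mathbb R^n$ has nonnegative entries. A Polish space is a complete separable metric space; $\mathcal P(\Xi)$ is the set of Borel probability measures. $C(S)$ denotes continuous real functions on $S$, and $C_{{\rm const},2}(S\times S)$ is the set of $\gamma\in C(S\times S)$ with $\gamma(\zeta,\xi)=\gamma(\zeta,\xi')$ for all $\zeta,\xi,\xi'\in S$ (functions not depending on the second argument). Primal: $\Pi(Q):=\{\pi\in\mathcal P(\Xi\times\Xi):\mathrm{pr}_{1\#}\pi=Q\}$; $\Pi(Q,\boldsymbol\epsilon):=\{\pi\in\Pi(Q):\int_{\Xi\times\Xi}c_k\,d\pi\le\epsilon_k\ \forall k\in[n]\}$; the multi-transport hyperrectangle is $\mathcal T(Q,\boldsymbol\epsilon):=\{\mathrm{pr}_{2\#}\pi:\pi\in\Pi(Q,\boldsymbol\epsilon)\}$. $\mathcal P^h(\Xi)$ is the set of $\nu\in\mathcal P(\Xi)$ for which at least one of $\int\max\{h,0\}\,d\nu$, $\int\min\{h,0\}\,d\nu$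 is finite (so $\int h\,d\nu$ is well defined in $[-\infty,+\infty]$). The primal value is $$\mathcal I^\star:=\sup_{P\in\mathcal T(Q,\boldsymbol\epsilon)\cap\mathcal P^h(\Xi)}\int_\Xi h\,dP=\sup\Big\{\int_{\Xi\times\Xi}h(\xi)\,d\pi(\zeta,\xi):\pi\in\Pi(Q,\boldsymbol\epsilon),\ \mathrm{pr}_{2\#}\pi\in\mathcal P^h(\Xi)\Big\}.$$ Dual: $\mathfrak m_{\mathcal U}(\Xi;\mathbb R\cup\{+\infty\})$ is the set of functions $\Xi\to\mathbb R\cup\{+\infty\}$ measurable with respect to the universal $\sigma$-algebra $\mathcal U(\Xi)=\bigcap_{P\in\mathcal P(\Xi)}\mathcal B_P(\Xi)$ ($\mathcal B_P(\Xi)$ is the $P$-completion of the Borel $\sigma$-algebra). $\Lambda$ is the set of pairs $(\boldsymbol\lambda,\varphi)$ with $\boldsymbol\lambda\succeq0$, $\varphi\in\mathfrak m_{\mathcal U}(\Xi;\mathbb R\cup\{+\infty\})$ and $\varphi(\zeta)\ge h(\xi)-\langle\boldsymbol\lambda,\boldsymbol c(\zeta,\xi)\rangle$ for all $\zeta,\xi\in\Xi$. $\mathcal J(\boldsymbol\lambda,\varphi):=\langle\boldsymbol\lambda,\boldsymbol\epsilon\rangle+\int_\Xi\varphi\,dQ$ (well defined in $\mathbb R\cup\{+\infty\}$ since $\varphi\ge h$), and $\mathcal J_\star:=\inf_{(\boldsymbol\lambda,\varphi)\in\Lambda}\mathcal J(\boldsymbol\lambda,\varphi)$. The functions $\varphi_{\boldsymbol\lambda}$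 are universally measurable. *)

theory Defs
  imports "HOL-Probability.Probability"
begin

definition usc :: "('a::topological_space \<Rightarrow> real) \<Rightarrow> bool" where
  "usc f \<longleftrightarrow> (\<forall>a. open {x. f x < a})"

definition lsc :: "('a::topological_space \<Rightarrow> real) \<Rightarrow> bool" where
  "lsc f \<longleftrightarrow> (\<forall>a. open {x. a < f x})"

definition borel_probs :: "'a::topological_space measure set" where
  "borel_probs = {M. sets M = sets borel \<and> prob_space M}"


text \<open>The integral of an extended-real function as the difference of the integrals of its positive and
  negative parts (\<^const>\<open>e2ennreal\<close> sends negative arguments to 0). It is the usual integral for
  measurable functions for which at least one of the two parts is finite. If both are infinite, the
  value is an artefact of \<open>\<infinity> - \<infinity> = \<infinity>\<close> on \<^typ>\<open>ereal\<close>; this case does not occur below: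
  in the primal it is excluded by \<open>probs_quasi_int\<close>, in the dual by \<open>\<phi> \<ge> h\<close> with \<open>h\<close> integrable.\<close>

definition ext_integral :: "'a measure \<Rightarrow> ('a \<Rightarrow> ereal) \<Rightarrow> ereal" where
  "ext_integral M f =
     enn2ereal (\<integral>\<^sup>+ x. e2ennreal (f x) \<partial>M) - enn2ereal (\<integral>\<^sup>+ x. e2ennreal (- f x) \<partial>M)"

lemma ext_integral_integrable:
  assumes "integrable M f"
  shows "ext_integral M (\<lambda>x. ereal (f x)) = ereal (integral\<^sup>L M f)"
proof -
  have fin: "(\<integral>\<^sup>+ x. ennreal (f x) \<partial>M) \<noteq> \<infinity>" "(\<integral>\<^sup>+ x. ennreal (- f x) \<partial>M) \<noteq> \<infinity>"
    using assms unfolding real_integrable_def by auto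
  then obtain p q where pq: "0 \<le> p" "(\<integral>\<^sup>+ x. ennreal (f x) \<partial>M) = ennreal p"
      "0 \<le> q" "(\<integral>\<^sup>+ x. ennreal (- f x) \<partial>M) = ennreal q"
    by (cases "\<integral>\<^sup>+ x. ennreal (f x) \<partial>M"; cases "\<integral>\<^sup>+ x. ennreal (- f x) \<partial>M") auto
  then show ?thesis
    unfolding ext_integral_def real_lebesgue_integral_def[OF assms]
    by (simp add: enn2ereal_ennreal)
qed


subsection \<open>Primal problem\<close>

definition couplings_from :: "'a::topological_space measure \<Rightarrow> ('a \<times> 'a) measure set" where
  "couplings_from Q = {\<pi> \<in> borel_probs. distr \<pi> borel fst = Q}"

definition couplings_within ::
    "('a::topological_space \<times> 'a \<Rightarrow> real ^ 'n) \<Rightarrow> 'a measure \<Rightarrow> real ^ 'n \<Rightarrow> ('a \<times> 'a) measure set" where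
  "couplings_within c Q \<epsilon> =
     {\<pi> \<in> couplings_from Q. \<forall>k. (\<integral>\<^sup>+ z. ennreal (c z $ k) \<partial>\<pi>) \<le> ennreal (\<epsilon> $ k)}"

definition transport_hyperrectangle ::
    "('a::topological_space \<times> 'a \<Rightarrow> real ^ 'n) \<Rightarrow> 'a measure \<Rightarrow> real ^ 'n \<Rightarrow> 'a measure set" where
  "transport_hyperrectangle c Q \<epsilon> = (\<lambda>\<pi>. distr \<pi> borel snd) ` couplings_within c Q \<epsilon>"

definition probs_quasi_int :: "('a::topological_space \<Rightarrow> real) \<Rightarrow> 'a measure set" where
  "probs_quasi_int h = {\<nu> \<in> borel_probs.
     (\<integral>\<^sup>+ x. ennreal (max (h x) 0) \<partial>\<nu>) < \<infinity> \<or> (\<integral>\<^sup>+ x. ennreal (- min (h x) 0) \<partial>\<nu>) < \<infinity>}"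

definition primal_value ::
    "('a::topological_space \<Rightarrow> real) \<Rightarrow> ('a \<times> 'a \<Rightarrow> real ^ 'n) \<Rightarrow> 'a measure \<Rightarrow> real ^ 'n \<Rightarrow> ereal" where
  "primal_value h c Q \<epsilon> =
     (SUP P \<in> transport_hyperrectangle c Q \<epsilon> \<inter> probs_quasi_int h. ext_integral P (\<lambda>x. ereal (h x)))"


subsection \<open>Dual problem\<close>

definition univ_borel :: "'a::topological_space measure" where
  "univ_borel = sigma UNIV (\<Inter>P\<in>borel_probs. sets (completion P))"

lemma space_univ_borel [simp]: "space univ_borel = UNIV"
  by (simp add: univ_borel_def space_measure_of_conv)

lemma sets_univ_borel:
  "sets (univ_borel :: 'a::topological_space measure) =
     (\<Inter>P\<in>(borel_probs :: 'a measure set). sets (completion P))"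
proof -
  let ?S = "\<Inter>P\<in>(borel_probs :: 'a measure set). sets (completion P)"
  have sp: "space (completion P) = UNIV" if "P \<in> borel_probs" for P :: "'a measure"
    using that sets_eq_imp_space_eq[of P borel] by (simp add: borel_probs_def)
  have "sigma_algebra UNIV ?S"
  proof (rule sigma_algebra_iff2[THEN iffD2], intro conjI ballI allI impI)
    show "?S \<subseteq> Pow UNIV" "{} \<in> ?S" by auto
    fix s assume s: "s \<in> ?S"
    show "UNIV - s \<in> ?S"
    proof (rule INT_I)
      fix P :: "'a measure" assume P: "P \<in> borel_probs"
      show "UNIV - s \<in> sets (completion P)"
        using sets.compl_sets[OF INT_D[OF s P]] unfolding sp[OF P] .
    qed
  next
    fix A :: "nat \<Rightarrow> 'a set" assume A: "range A \<subseteq> ?S"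
    show "(\<Union>i. A i) \<in> ?S"
    proof (rule INT_I)
      fix P :: "'a measure" assume P: "P \<in> borel_probs"
      have "range A \<subseteq> sets (completion P)" using A P by blast
      then show "(\<Union>i. A i) \<in> sets (completion P)" by (rule sets.countable_UN)
    qed
  qed
  then show ?thesis
    unfolding univ_borel_def by (rule sigma_algebra.sets_measure_of_eq)
qed

definition dual_feasible ::
    "('a::topological_space \<Rightarrow> real) \<Rightarrow> ('a \<times> 'a \<Rightarrow> real ^ 'n) \<Rightarrow> ((real ^ 'n) \<times> ('a \<Rightarrow> ereal)) set" where
  "dual_feasible h c = {(l, \<phi>).
     (\<forall>k. 0 \<le> l $ k) \<and>
     \<phi> \<in> borel_measurable univ_borel \<and> (\<forall>\<zeta>. \<phi> \<zeta> \<noteq> - \<infinity>) \<and>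
     (\<forall>\<zeta> \<xi>. ereal (h \<xi> - l \<bullet> c (\<zeta>, \<xi>)) \<le> \<phi> \<zeta>)}"

text \<open>Universally measurable functions need not be Borel, so they are integrated against the completion
  of \<open>Q\<close>.\<close>

definition dual_objective ::
    "'a measure \<Rightarrow> real ^ 'n \<Rightarrow> real ^ 'n \<Rightarrow> ('a \<Rightarrow> ereal) \<Rightarrow> ereal" where
  "dual_objective Q \<epsilon> l \<phi> = ereal (l \<bullet> \<epsilon>) + ext_integral (completion Q) \<phi>"

definition dual_value ::
    "('a::topological_space \<Rightarrow> real) \<Rightarrow> ('a \<times> 'a \<Rightarrow> real ^ 'n) \<Rightarrow> 'a measure \<Rightarrow> real ^ 'n \<Rightarrow> ereal" where
  "dual_value h c Q \<epsilon> = (INF (l, \<phi>) \<in> dual_feasible h c. dual_objective Q \<epsilon> l \<phi>)"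

definition dual_potential ::
    "('a \<Rightarrow> real) \<Rightarrow> ('a \<times> 'a \<Rightarrow> real ^ 'n) \<Rightarrow> real ^ 'n \<Rightarrow> 'a \<Rightarrow> ereal" where
  "dual_potential h c l \<zeta> = (SUP \<xi>. ereal (h \<xi> - l \<bullet> c (\<zeta>, \<xi>)))"


subsection \<open>Function spaces on a subset\<close>

text \<open>Functions on a subset \<open>S\<close> are represented by total functions that are \<^const>\<open>undefined\<close> outside
  \<open>S\<close>, so that equality is equality on \<open>S\<close>.\<close>

definition cont_funs :: "'b::topological_space set \<Rightarrow> ('b \<Rightarrow> real) set" where
  "cont_funs S = {\<gamma> \<in> extensional S. continuous_on S \<gamma>}"

definition cont_funs_const2 :: "'a::topological_space set \<Rightarrow> ('a \<times> 'a \<Rightarrow> real) set" where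
  "cont_funs_const2 S =
     {\<gamma> \<in> cont_funs (S \<times> S). \<forall>\<zeta>\<in>S. \<forall>\<xi>\<in>S. \<forall>\<xi>'\<in>S. \<gamma> (\<zeta>, \<xi>) = \<gamma> (\<zeta>, \<xi>')}"

definition fun_span_on :: "'b set \<Rightarrow> ('n::finite \<Rightarrow> 'b \<Rightarrow> real) \<Rightarrow> ('b \<Rightarrow> real) set" where
  "fun_span_on S f = {restrict (\<lambda>z. \<Sum>k\<in>UNIV. a k * f k z) S | a. True}"

definition lin_indep_on :: "'b set \<Rightarrow> ('n::finite \<Rightarrow> 'b \<Rightarrow> real) \<Rightarrow> bool" where
  "lin_indep_on S f \<longleftrightarrow>
     (\<forall>a. restrict (\<lambda>z. \<Sum>k\<in>UNIV. a k * f k z) S = restrict (\<lambda>z. 0) S \<longrightarrow> (\<forall>k. a k = 0))"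

end

theory Submission
  imports Defs
begin

text \<open>The set of attainable pairs of expected reward and cost vector (enlarged downwards in the
  reward and upwards in the costs) is convex, and the diagonal coupling has zero cost, so Slater's
  condition holds because all \<open>\<epsilon>\<^sub>k\<close> are positive. Separating the point (primal value, \<open>\<epsilon>\<close>) from this
  finite-dimensional set gives a multiplier \<open>\<lambda>\<close> with
  \<open>\<integral>h(\<xi>) - \<langle>\<lambda>,c(\<zeta>,\<xi>)\<rangle> d\<pi> \<le> I\<^sup>\<star> - \<langle>\<lambda>,\<epsilon>\<rangle>\<close> for all couplings \<open>\<pi>\<close> of finite cost. Since the integrand is upper
  semicontinuous, its superlevel sets are closed, and a measurable selection from them shows that the
  supremum of the left-hand side over couplings carried by graphs of Borel maps is already
  \<open>\<integral>\<phi>\<^sub>\<lambda> dQ\<close>. Hence \<open>\<lambda>\<close> is dual optimal.\<close>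

subsection \<open>Projections of closed sets and measurable selection\<close>

text \<open>Two obstacles shape the proof. First, \<Xi> need not be compact, so the inner supremum
  may have no maximiser, and near-maximisers chosen pointwise may have reward or costs that are not
  integrable. The diagonal repairs this: staying put costs nothing and earns \<open>h\<close>, which
  is integrable. A selection is therefore followed only where reward and costs stay below a bound,
  and the identity is used elsewhere; letting the bound grow loses nothing in the supremum. The
  identity also starts the increasing sequence of payoffs, which gives monotone convergence its
  integrable lower bound. Second, the projection of a closed set need not be Borel. It is shown to
  be Borel up to a null set of any given finite Borel measure. This yields both the universal
  measurability of the potential and Borel selections outside a \<open>Q\<close>-null set. An
  infinite primal value needs no separation, since the zero multiplier then serves.\<close>

lemma dense_sequence:
  obtains d :: "nat \<Rightarrow> 'a::{metric_space, second_countable_topology}"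
  where "\<And>y e. 0 < e \<Longrightarrow> \<exists>i. dist (d i) y < e"
proof -
  obtain D :: "'a set" where D: "countable D" "\<And>X. open X \<Longrightarrow> X \<noteq> {} \<Longrightarrow> \<exists>x\<in>D. x \<in> X"
    using countable_dense_setE by blast
  have "D \<noteq> {}" using D(2)[of UNIV] by auto
  show thesis
  proof
    fix y :: 'a and e :: real assume "0 < e"
    then obtain x where "x \<in> D" "x \<in> ball y e"
      using D(2)[of "ball y e"] by auto
    then show "\<exists>i. dist (from_nat_into D i) y < e"
      using from_nat_into_surj[OF D(1)] by (metis dist_commute mem_ball)
  qed
qed

lemma totally_bounded_sequence_subseq:
  fixes y :: "nat \<Rightarrow> 'a::complete_space"
  assumes "\<And>e. 0 < e \<Longrightarrow> \<exists>k. finite k \<and> range y \<subseteq> (\<Union>x\<in>k. cball x e)"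
  obtains l r where "strict_mono r" "(y \<circ> r) \<longlonglongrightarrow> l"
proof -
  have "compact (closure (range y))"
    unfolding compact_eq_totally_bounded complete_eq_closed
  proof (intro conjI allI impI closed_closure)
    fix e :: real assume e: "0 < e"
    \<comment> \<open>Half the radius and closed balls: the finite union is then closed, hence
      contains the closure, and the open balls of full radius cover it.\<close>
    obtain k where k: "finite k" "range y \<subseteq> (\<Union>x\<in>k. cball x (e/2))"
      using assms[of "e/2"] e by auto
    have "closed (\<Union>x\<in>k. cball x (e/2))" using k(1) by (intro closed_UN) auto
    then have "closure (range y) \<subseteq> (\<Union>x\<in>k. cball x (e/2))"
      using k(2) by (rule closure_minimal[rotated])
    also have "\<dots> \<subseteq> (\<Union>x\<in>k. ball x e)" using e by (intro UN_mono) auto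
    finally show "\<exists>k. finite k \<and> closure (range y) \<subseteq> (\<Union>x\<in>k. ball x e)"
      using k(1) by blast
  qed
  moreover have "\<forall>n. y n \<in> closure (range y)" using closure_subset[of "range y"] by auto
  ultimately show thesis
    unfolding compact_eq_seq_compact_metric seq_compact_def using that by metis
qed

text \<open>Inner regularity of the projection, without compactness of the first factor: outer measure is
  continuous from below, so the second coordinate can be restricted to finitely many balls of radius
  \<open>1/(k+1)\<close> for every \<open>k\<close> in turn. By total boundedness, every point in the closures of all the
  resulting projections still lies in the projection of \<open>C\<close>.\<close>

lemma closed_projection_inner:
  fixes C :: "('a::{metric_space, second_countable_topology} \<times> 'b::polish_space) set"
  assumes C: "closed C" and P: "sets P = sets borel" "finite_measure P"
    and a: "a < outer_measure_of P (fst ` C)"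
  obtains D where "closed D" "D \<subseteq> fst ` C" "a \<le> emeasure P D"
proof -
  interpret finite_measure P by fact
  have sp: "space P = UNIV" using sets_eq_imp_space_eq[OF P(1)] by simp
  obtain d :: "nat \<Rightarrow> 'b" where d: "\<And>y e. 0 < e \<Longrightarrow> \<exists>i. dist (d i) y < e"
    by (rule dense_sequence) blast
  define U where "U k m = (\<Union>i<m. cball (d i) (1 / Suc k))" for k m :: nat
  have "\<exists>B. \<forall>n. (a < outer_measure_of P (fst ` B n) \<and> B n \<subseteq> C) \<and>
            (\<exists>m. B (Suc n) = B n \<inter> (UNIV \<times> U n m))"
  proof (rule dependent_nat_choice)
    show "\<exists>x. a < outer_measure_of P (fst ` x) \<and> x \<subseteq> C" using a by auto
  next
    fix B n assume B: "a < outer_measure_of P (fst ` B) \<and> B \<subseteq> C"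
    let ?A = "\<lambda>m. fst ` (B \<inter> (UNIV \<times> U n m))"
    have "B \<subseteq> (\<Union>m. B \<inter> (UNIV \<times> U n m))"
    proof
      fix z assume z: "z \<in> B"
      obtain i where "dist (d i) (snd z) < 1 / Suc n" using d[of "1 / Suc n"] by auto
      then have "snd z \<in> U n (Suc i)" unfolding U_def by (auto intro!: bexI[of _ i])
      then show "z \<in> (\<Union>m. B \<inter> (UNIV \<times> U n m))" using z by (cases z) auto
    qed
    then have "(\<Union>m. B \<inter> (UNIV \<times> U n m)) = B" by blast
    then have "(\<Union>m. ?A m) = fst ` B" by (simp only: image_UN[symmetric])
    moreover have "incseq ?A"
      unfolding incseq_def U_def by (intro allI impI image_mono Int_mono Sigma_mono UN_mono order_refl) auto
    ultimately have "(SUP m. outer_measure_of P (?A m)) = outer_measure_of P (fst ` B)"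
      using SUP_outer_measure_of_incseq[of ?A P] unfolding sp by (simp only: subset_UNIV)
    then obtain m where "a < outer_measure_of P (?A m)"
      using B less_SUP_iff[of a "\<lambda>m. outer_measure_of P (?A m)" UNIV] by auto
    then show "\<exists>y. (a < outer_measure_of P (fst ` y) \<and> y \<subseteq> C) \<and> (\<exists>m. y = B \<inter> (UNIV \<times> U n m))"
      using B by blast
  qed
  then obtain B where B: "\<And>n. a < outer_measure_of P (fst ` B n)" "\<And>n. B n \<subseteq> C"
      and "\<forall>n. \<exists>m. B (Suc n) = B n \<inter> (UNIV \<times> U n m)"
    by blast
  then obtain m where Bm: "\<And>n. B (Suc n) = B n \<inter> (UNIV \<times> U n (m n))"
    by metis
  have dec: "decseq B" using Bm by (auto simp: decseq_Suc_iff)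
  define D where "D = (\<Inter>n. closure (fst ` B n))"
  have "D \<subseteq> fst ` C"
  proof
    fix x assume "x \<in> D"
    then have "x \<in> closure (fst ` B n)" for n unfolding D_def by blast
    then have "\<exists>y\<in>fst ` B n. dist y x < inverse (Suc n)" for n
      unfolding closure_approachable by (meson inverse_positive_iff_positive of_nat_0_less_iff zero_less_Suc)
    then have "\<exists>p. p \<in> B n \<and> dist (fst p) x < inverse (Suc n)" for n
      by blast
    then obtain p where p: "\<And>n. p n \<in> B n" "\<And>n. dist (fst (p n)) x < inverse (Suc n)"
      by metis
    have "(\<lambda>n. dist (fst (p n)) x) \<longlonglongrightarrow> 0"
      by (rule tendsto_sandwich[OF _ _ tendsto_const LIMSEQ_inverse_real_of_nat])
         (use less_imp_le[OF p(2)] in simp_all)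
    then have lx: "(\<lambda>n. fst (p n)) \<longlonglongrightarrow> x" by (simp add: tendsto_dist_iff[symmetric])
    have "\<exists>k. finite k \<and> range (snd \<circ> p) \<subseteq> (\<Union>x\<in>k. cball x e)" if e: "0 < e" for e
    proof -
      obtain k where k: "1 / Suc k < e" using nat_approx_posE[OF e] by auto
      \<comment> \<open>For \<open>n > k\<close> the point \<open>p n\<close> lies in
        \<open>B (Suc k)\<close>, where finitely many balls of radius \<open>1 / Suc k\<close>
        suffice. The remaining finitely many points serve as their own centres.\<close>
      have "snd (p n) \<in> (\<Union>x\<in>d ` {..<m k} \<union> (\<lambda>n. snd (p n)) ` {..k}. cball x e)" for n
      proof (cases "n \<le> k")
        case True
        then show ?thesis using e by (intro UN_I[of "snd (p n)"]) auto
      next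
        case False
        then have "p n \<in> B (Suc k)" using decseqD[OF dec, of "Suc k" n] p(1)[of n] by auto
        then have "snd (p n) \<in> U k (m k)" unfolding Bm by auto
        then obtain i where "i < m k" "dist (d i) (snd (p n)) \<le> 1 / Suc k" unfolding U_def by auto
        then show ?thesis using k by (intro UN_I[of "d i"]) auto
      qed
      then show ?thesis
        by (intro exI[of _ "d ` {..<m k} \<union> (\<lambda>n. snd (p n)) ` {..k}"] conjI image_subsetI)
           (simp_all only: o_def finite_Un finite_imageI finite_lessThan finite_atMost)
    qed
    then obtain l r where r: "strict_mono r" "((snd \<circ> p) \<circ> r) \<longlonglongrightarrow> l"
      by (rule totally_bounded_sequence_subseq)
    have "(\<lambda>n. (fst (p (r n)), snd (p (r n)))) \<longlonglongrightarrow> (x, l)"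
      using LIMSEQ_subseq_LIMSEQ[OF lx r(1)] r(2) by (intro tendsto_Pair) (simp_all add: o_def)
    then have lim: "(\<lambda>n. p (r n)) \<longlonglongrightarrow> (x, l)" by (simp only: prod.collapse)
    have "p (r n) \<in> C" for n using p(1) B(2) by (rule subsetD[rotated])
    then have "(x, l) \<in> C" using lim by (rule closed_sequentially[OF C])
    then show "x \<in> fst ` C" by (rule image_eqI[rotated]) simp
  qed
  moreover have "a \<le> emeasure P D"
  proof -
    have "range (\<lambda>n. closure (fst ` B n)) \<subseteq> sets P" unfolding P(1) by (intro image_subsetI borel_closed closed_closure)
    moreover have "decseq (\<lambda>n. closure (fst ` B n))"
      using dec unfolding decseq_def by (intro allI impI closure_mono image_mono) simp
    ultimately have "emeasure P D = (INF n. emeasure P (closure (fst ` B n)))"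
      unfolding D_def by (intro INF_emeasure_decseq[symmetric]) (auto simp: emeasure_eq_measure)
    also have "a \<le> \<dots>"
    proof (rule INF_greatest)
      fix n
      have "a \<le> outer_measure_of P (closure (fst ` B n))"
        using less_imp_le[OF B(1)] outer_measure_of_mono[OF closure_subset] by (rule order_trans)
      then show "a \<le> emeasure P (closure (fst ` B n))" using P(1) by simp
    qed
    finally show ?thesis .
  qed
  moreover have "closed D" unfolding D_def by (intro closed_INT ballI closed_closure)
  ultimately show thesis by (intro that)
qed

text \<open>A measurable hull \<open>G\<close> of the projection has the same outer measure, and
  countably many closed subsets of the projection exhaust that measure, so by finiteness they differ
  from \<open>G\<close> by a null set. Outer measure zero is treated apart because no value lies
  strictly below it.\<close>

lemma closed_projection_core:
  fixes C :: "('a::{metric_space, second_countable_topology} \<times> 'b::polish_space) set"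
  assumes C: "closed C" and P: "sets P = sets borel" "finite_measure P"
  obtains E N where "E \<in> sets borel" "N \<in> null_sets P" "E \<subseteq> fst ` C" "fst ` C \<subseteq> E \<union> N"
proof (cases "outer_measure_of P (fst ` C) = 0")
  interpret finite_measure P by fact
  have sp: "space P = UNIV" using sets_eq_imp_space_eq[OF P(1)] by simp
  obtain G where G: "G \<in> sets P" "fst ` C \<subseteq> G" "outer_measure_of P (fst ` C) = emeasure P G"
    using outer_measure_of_attain[of "fst ` C" P] sp by auto
  {
    case True
    then show thesis using G that[of "{}" G] by auto
  next
    case False
    then have "0 < outer_measure_of P (fst ` C)" by (simp add: zero_less_iff_neq_zero)
    then obtain u where u: "\<And>n. u n < outer_measure_of P (fst ` C)"
        "u \<longlonglongrightarrow> outer_measure_of P (fst ` C)"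
      using approx_from_below_dense_linorder by blast
    have "\<exists>D. closed D \<and> D \<subseteq> fst ` C \<and> u n \<le> emeasure P D" for n
      using closed_projection_inner[OF C P u(1)] by blast
    then obtain D where D: "\<And>n. closed (D n)" "\<And>n. D n \<subseteq> fst ` C" "\<And>n. u n \<le> emeasure P (D n)"
      by metis
    let ?E = "\<Union>n. D n"
    have E: "?E \<in> sets P" using D(1) P(1) by auto
    have "u n \<le> emeasure P ?E" for n
      using D(3) emeasure_mono[OF UN_upper[OF UNIV_I] E] by (rule order_trans)
    then have "emeasure P G \<le> emeasure P ?E"
      using u(2) G(3) by (intro LIMSEQ_le_const2[of u]) auto
    moreover have sub: "?E \<subseteq> G" using D(2) G(2) by blast
    ultimately have "emeasure P (G - ?E) = 0"
      using emeasure_Diff[of P ?E G] E G(1) by (simp add: emeasure_eq_measure ennreal_minus ennreal_neg)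
    then have "G - ?E \<in> null_sets P" using E G(1) by auto
    moreover have "?E \<in> sets borel" using E P(1) by simp
    moreover have "?E \<subseteq> fst ` C" using D(2) by (rule UN_least)
    moreover have "fst ` C \<subseteq> ?E \<union> (G - ?E)" using G(2) by (simp only: Un_Diff_cancel) (rule le_supI2)
    ultimately show thesis by (intro that)
  }
qed

lemma closed_projection_completion:
  fixes C :: "('a::{metric_space, second_countable_topology} \<times> 'b::polish_space) set"
  assumes "closed C" "sets P = sets borel" "finite_measure P"
  shows "fst ` C \<in> sets (completion P)"
proof -
  obtain E N where *: "E \<in> sets borel" "N \<in> null_sets P" "E \<subseteq> fst ` C" "fst ` C \<subseteq> E \<union> N"
    by (rule closed_projection_core[OF assms])
  then show ?thesis
    using assms(2) by (intro sets_completionI[of _ E "fst ` C - E" N]) blast+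
qed

text \<open>The successive approximation of the Kuratowski and Ryll-Nardzewski theorem, where the projections
  of the pieces \<open>T n i\<close>, which need not be Borel, are replaced by the Borel sets \<open>E n i\<close> at the price of a
  null set.\<close>

lemma closed_selection:
  fixes C :: "('a::{metric_space, second_countable_topology} \<times> 'b::polish_space) set"
  assumes C: "closed C" and P: "sets P = sets borel" "finite_measure P"
  obtains s N where "s \<in> borel_measurable borel" "N \<in> null_sets P"
    "\<And>x. x \<in> fst ` C \<Longrightarrow> x \<notin> N \<Longrightarrow> (x, s x) \<in> C"
proof -
  obtain d :: "nat \<Rightarrow> 'b" where d: "\<And>y e. 0 < e \<Longrightarrow> \<exists>i. dist (d i) y < e"
    by (rule dense_sequence) blast
  define T where "T n i = C \<inter> (UNIV \<times> cball (d i) ((1/2)^n))" for n i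
  have cl: "closed (T n i)" for n i unfolding T_def using C by (intro closed_Int closed_Times) auto
  have "\<exists>E N. E \<in> sets borel \<and> N \<in> null_sets P \<and> E \<subseteq> fst ` T n i \<and> fst ` T n i \<subseteq> E \<union> N" for n i
    using closed_projection_core[OF cl P] by metis
  then obtain E N where E[measurable]: "\<And>n i. E n i \<in> sets borel" and N: "\<And>n i. N n i \<in> null_sets P"
      and EN: "\<And>n i. E n i \<subseteq> fst ` T n i" "\<And>n i. fst ` T n i \<subseteq> E n i \<union> N n i"
    by metis
  obtain E0 N0 where E0[measurable]: "E0 \<in> sets borel" and N0: "N0 \<in> null_sets P"
      and E0C: "E0 \<subseteq> fst ` C" "fst ` C \<subseteq> E0 \<union> N0"
    by (rule closed_projection_core[OF C P])
  have hitD: "\<exists>y. (x, y) \<in> C \<and> dist (d i) y \<le> (1/2)^n" if "x \<in> E n i" for x n i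
    using subsetD[OF EN(1) that] by (auto simp: T_def)
  define M where "M = N0 \<union> (\<Union>n i. N n i)"
  have M: "M \<in> null_sets P" unfolding M_def using N N0 by (intro null_sets.Un null_sets_UN) auto
  then have [measurable]: "M \<in> sets borel" using P(1) by auto
  \<comment> \<open>\<open>I n x\<close> indexes a centre within \<open>(1/2)^n\<close> of the
    section of \<open>C\<close> over \<open>x\<close>. The next centre is sought within
    \<open>(1/2)^(Suc n)\<close> of a point of the section that is \<open>(1/2)^n\<close>-close to
    the current one, so the two centres are less than \<open>2 * (1/2)^n\<close> apart. Taking the
    least index keeps the choice Borel.\<close>
  define I where "I = rec_nat (\<lambda>x. LEAST i. x \<in> E 0 i)
      (\<lambda>n f x. LEAST i. x \<in> E (Suc n) i \<and> dist (d i) (d (f x)) < 2 * (1/2)^n)"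
  have I0: "I 0 = (\<lambda>x. LEAST i. x \<in> E 0 i)"
    and IS: "\<And>n. I (Suc n) = (\<lambda>x. LEAST i. x \<in> E (Suc n) i \<and> dist (d i) (d (I n x)) < 2 * (1/2)^n)"
    by (simp_all add: I_def)
  have mI: "I n \<in> measurable borel (count_space UNIV)" for n
  proof (induction n)
    case 0 show ?case unfolding I0 by measurable
  next
    case (Suc n)
    note [measurable] = Suc
    show ?case unfolding IS by measurable
  qed
  \<comment> \<open>The constant default \<open>d 0\<close> makes the sequence converge at every
    point, so that its limit is Borel on the whole space.\<close>
  define v where "v n x = (if x \<in> E0 - M then d (I n x) else d 0)" for n x
  have mv: "v n \<in> borel_measurable borel" for n
  proof -
    note [measurable] = mI
    show ?thesis unfolding v_def by measurable
  qed
  have conv: "\<exists>l. (\<lambda>n. d (I n x)) \<longlonglongrightarrow> l \<and> (x, l) \<in> C" if x: "x \<in> E0 - M" for x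
  proof -
    \<comment> \<open>Outside \<open>M\<close> the Borel sets \<open>E n i\<close> and the true
      projections of \<open>T n i\<close> have the same points.\<close>
    have hit: "x \<in> E n i" if "x \<in> fst ` T n i" for n i using that EN(2) x unfolding M_def by blast
    have pos: "0 < (1/2::real)^n" for n by simp
    have inE: "x \<in> E n (I n x)" and stp: "dist (d (I (Suc n) x)) (d (I n x)) < 2 * (1/2)^n" for n
    proof -
      have ex: "\<exists>i. x \<in> E (Suc n) i \<and> dist (d i) (d (I n x)) < 2 * (1/2)^n" if mem: "x \<in> E n (I n x)" for n
      proof -
        obtain y where y: "(x, y) \<in> C" "dist (d (I n x)) y \<le> (1/2)^n"
          using hitD[OF mem] by blast
        obtain i where i: "dist (d i) y < (1/2)^(Suc n)" using d[of "(1/2)^(Suc n)" y] by auto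
        have "x \<in> fst ` T (Suc n) i"
          using y i unfolding T_def by (intro image_eqI[of _ _ "(x, y)"]) auto
        moreover have "dist (d i) (d (I n x)) < 2 * (1/2)^n"
          using dist_triangle[of "d i" "d (I n x)" y] y(2) i dist_commute[of y "d (I n x)"]
            pos[of n] unfolding power_Suc by linarith
        ultimately show ?thesis using hit by blast
      qed
      have "\<exists>i. x \<in> E 0 i"
      proof -
        obtain y where y: "(x, y) \<in> C" using x E0C by auto
        obtain i where i: "dist (d i) y < (1/2)^0" using d[of 1 y] by auto
        then have "x \<in> fst ` T 0 i"
          using y unfolding T_def by (intro image_eqI[of _ _ "(x, y)"]) auto
        then show ?thesis using hit by blast
      qed
      then have b: "x \<in> E 0 (I 0 x)" unfolding I0 by (rule LeastI_ex)
      have s: "x \<in> E (Suc n) (I (Suc n) x) \<and> dist (d (I (Suc n) x)) (d (I n x)) < 2 * (1/2)^n"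
        if "x \<in> E n (I n x)" for n
        using LeastI_ex[OF ex[OF that]] unfolding IS .
      show inE: "x \<in> E n (I n x)" for n by (induction n) (use b s in auto)
      show "dist (d (I (Suc n) x)) (d (I n x)) < 2 * (1/2)^n" using s inE by blast
    qed
    have "Cauchy (\<lambda>n. d (I n x))"
    proof (rule metric_CauchyI)
      fix e :: real assume "0 < e"
      obtain k where k: "(1/2)^k < e / 8" using real_arch_pow_inv[of "e/8" "1/2"] \<open>0 < e\<close> by auto
      \<comment> \<open>The steps \<open>2 * (1/2)^i\<close> from \<open>i = k\<close> on form a
        geometric series with sum \<open>4 * (1/2)^k\<close>, which the choice \<open>e / 8\<close>
        brings below \<open>e / 2\<close>.\<close>
      have bd: "dist (d (I (k + j) x)) (d (I k x)) \<le> 4 * (1/2)^k - 4 * (1/2)^(k+j)" for j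
      proof (induction j)
        case (Suc j)
        then show ?case
          using dist_triangle[of "d (I (k + Suc j) x)" "d (I k x)" "d (I (k + j) x)"] stp[of "k + j"]
          by simp
      qed simp
      then have bd': "dist (d (I n x)) (d (I k x)) < e / 2" if "n \<ge> k" for n
      proof -
        have "dist (d (I n x)) (d (I k x)) \<le> 4 * (1/2)^k - 4 * (1/2)^n" using bd[of "n - k"] that by simp
        then show ?thesis using k pos[of n] by linarith
      qed
      show "\<exists>M. \<forall>m\<ge>M. \<forall>n\<ge>M. dist (d (I m x)) (d (I n x)) < e"
        using dist_triangle_half_l[OF bd' bd'] by (intro exI[of _ k]) auto
    qed
    then obtain l where l: "(\<lambda>n. d (I n x)) \<longlonglongrightarrow> l" using Cauchy_convergent convergent_def by blast
    \<comment> \<open>The centres need not lie in the section of \<open>C\<close> over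
      \<open>x\<close>. The nearby points \<open>y n\<close> do and have the same limit, so
      closedness of \<open>C\<close> places that limit in the section.\<close>
    have "\<exists>y. (x, y) \<in> C \<and> dist (d (I n x)) y \<le> (1/2)^n" for n
      using hitD[OF inE] .
    then obtain y where y: "\<And>n. (x, y n) \<in> C" "\<And>n. dist (d (I n x)) (y n) \<le> (1/2)^n" by metis
    have dy: "(\<lambda>n. dist (d (I n x)) (y n)) \<longlonglongrightarrow> 0"
      by (rule tendsto_sandwich[OF _ _ tendsto_const LIMSEQ_realpow_zero[of "1/2::real"]]) (auto simp: y(2))
    have "(\<lambda>n. dist (d (I n x)) (y n) + dist (d (I n x)) l) \<longlonglongrightarrow> 0"
      using tendsto_add[OF dy tendsto_dist_iff[THEN iffD1, OF l]] by (simp only: add_0_right)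
    then have "(\<lambda>n. dist (y n) l) \<longlonglongrightarrow> 0"
      by (rule tendsto_sandwich[OF _ _ tendsto_const, rotated 2])
         (simp_all only: zero_le_dist dist_triangle3 eventually_True)
    then have "y \<longlonglongrightarrow> l" by (rule tendsto_dist_iff[THEN iffD2])
    then have "(\<lambda>n. (x, y n)) \<longlonglongrightarrow> (x, l)" by (intro tendsto_intros)
    with y(1) have "(x, l) \<in> C" by (rule closed_sequentially[OF C])
    with l have "(\<lambda>n. d (I n x)) \<longlonglongrightarrow> l \<and> (x, l) \<in> C" by (rule conjI)
    then show ?thesis by (rule exI)
  qed
  have "\<forall>x\<in>E0 - M. \<exists>l. (\<lambda>n. d (I n x)) \<longlonglongrightarrow> l \<and> (x, l) \<in> C"
    by (rule ballI) (rule conv)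
  from bchoice[OF this] obtain f
    where f: "\<forall>x\<in>E0 - M. (\<lambda>n. d (I n x)) \<longlonglongrightarrow> f x \<and> (x, f x) \<in> C" by (rule exE)
  define s where "s x = (if x \<in> E0 - M then f x else d 0)" for x
  have sC: "(x, s x) \<in> C" if "x \<in> E0 - M" for x
    using bspec[OF f that] by (simp only: s_def that if_True simp_thms)
  have lim: "(\<lambda>n. v n x) \<longlonglongrightarrow> s x" for x
  proof (cases "x \<in> E0 - M")
    case True
    then show ?thesis using bspec[OF f True] by (simp only: s_def v_def True if_True)
  next
    case False
    then show ?thesis by (simp only: s_def v_def if_False tendsto_const)
  qed
  show thesis
  proof (rule that[OF _ M])
    show "s \<in> borel_measurable borel"
      by (rule borel_measurable_LIMSEQ_metric[OF mv lim])
    fix x assume x: "x \<in> fst ` C" "x \<notin> M"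
    moreover have "x \<notin> N0" using x(2) by (simp add: M_def)
    ultimately show "(x, s x) \<in> C" using E0C(2) by (intro sC) auto
  qed
qed

subsection \<open>Semicontinuity and the dual potential\<close>

lemma usc_add:
  assumes "usc f" "usc g"
  shows "usc (\<lambda>x. f x + g x)"
  unfolding usc_def
proof
  fix a
  have "{x. f x + g x < a} = (\<Union>r. {x. f x < r} \<inter> {x. g x < a - r})"
  proof (intro set_eqI iffI)
    fix x assume "x \<in> {x. f x + g x < a}"
    \<comment> \<open>The witness exceeds \<open>f x\<close> by half of the gap
      \<open>a - f x - g x\<close>, leaving the other half to \<open>g x\<close>.\<close>
    then show "x \<in> (\<Union>r. {x. f x < r} \<inter> {x. g x < a - r})"
      by (intro UN_I[of "f x + (a - f x - g x) / 2"]) (auto simp: field_simps)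
  qed auto
  also have "open \<dots>"
    using assms unfolding usc_def by (intro open_UN ballI open_Int) simp_all
  finally show "open {x. f x + g x < a}" .
qed

lemma usc_const: "usc (\<lambda>x. b)"
  by (simp add: usc_def)

lemma usc_sum:
  assumes "\<And>i. i \<in> A \<Longrightarrow> usc (f i)"
  shows "usc (\<lambda>x. \<Sum>i\<in>A. f i x)"
  using assms by (induction A rule: infinite_finite_induct) (auto intro: usc_add usc_const)

lemma usc_compose:
  assumes "usc f" "continuous_on UNIV g"
  shows "usc (\<lambda>x. f (g x))"
  using assms open_vimage[of "{y. f y < a}" g for a] by (auto simp: usc_def vimage_def)

lemma usc_uminus_scaled:
  assumes "lsc g" "0 \<le> t"
  shows "usc (\<lambda>x. - (t * g x))"
proof (cases "t = 0")
  case False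
  then have "{x. - (t * g x) < a} = {x. - a / t < g x}" for a
    using assms(2) by (auto simp: field_simps)
  then show ?thesis using assms(1) unfolding usc_def lsc_def by metis
qed (simp add: usc_const)

lemma closed_usc_superlevel: "usc f \<Longrightarrow> closed {x. q \<le> f x}"
  unfolding usc_def closed_def by (simp add: Collect_neg_eq[symmetric] not_le)

lemma usc_borel_measurable:
  assumes "usc f"
  shows "f \<in> borel_measurable borel"
proof (rule borel_measurableI_less)
  show "{x \<in> space borel. f x < y} \<in> sets borel" for y
    using borel_open[OF assms[unfolded usc_def, rule_format, of y]] by simp
qed

lemma lsc_borel_measurable:
  assumes "lsc f"
  shows "f \<in> borel_measurable borel"
proof (rule borel_measurableI_greater)
  show "{x \<in> space borel. y < f x} \<in> sets borel" for y
    using borel_open[OF assms[unfolded lsc_def, rule_format, of y]] by simp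
qed

text \<open>The integrand of the Lagrangian without the constant
  \<open>l \<bullet> \<epsilon>\<close>, as a function on the product space, where its superlevel
  sets can be projected.\<close>

definition payoff :: "('a \<Rightarrow> real) \<Rightarrow> ('a \<times> 'a \<Rightarrow> real ^ 'n) \<Rightarrow> real ^ 'n \<Rightarrow> 'a \<times> 'a \<Rightarrow> real" where
  "payoff h c l z = h (snd z) - l \<bullet> c z"

lemma usc_payoff:
  fixes h :: "'a::topological_space \<Rightarrow> real" and c :: "'a \<times> 'a \<Rightarrow> real ^ 'n"
  assumes "usc h" "\<And>k. lsc (\<lambda>z. c z $ k)" "\<And>k. 0 \<le> l $ k"
  shows "usc (payoff h c l)"
proof -
  have "usc (\<lambda>z::'a \<times> 'a. h (snd z))"
    by (rule usc_compose[OF assms(1)]) (rule continuous_on_snd[OF continuous_on_id])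
  moreover have "usc (\<lambda>z. \<Sum>k\<in>UNIV. - (l $ k * c z $ k))"
    using assms(2,3) by (rule usc_sum[OF usc_uminus_scaled])
  ultimately have "usc (\<lambda>z. h (snd z) + (\<Sum>k\<in>UNIV. - (l $ k * c z $ k)))"
    by (rule usc_add)
  then show ?thesis by (simp add: payoff_def[abs_def] inner_vec_def sum_negf)
qed

lemma dual_potential_eq: "dual_potential h c l x = (SUP y. ereal (payoff h c l (x, y)))"
  by (simp add: dual_potential_def payoff_def)

text \<open>The strict inequality leaves room for a rational below some payoff. Hence the strict
  superlevel sets of the potential are countable unions of projections of non-strict superlevel sets
  of the payoff, which are closed when the payoff is upper semicontinuous.\<close>

lemma dual_potential_greater_iff:
  fixes c :: "'a \<times> 'a \<Rightarrow> real ^ 'n"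
  shows "a < dual_potential h c l x \<longleftrightarrow>
    (\<exists>q\<in>{q::rat. a < ereal (of_rat q)}. x \<in> fst ` {z. of_rat q \<le> payoff h c l z})"
proof
  assume "a < dual_potential h c l x"
  then obtain y where "a < ereal (payoff h c l (x, y))" unfolding dual_potential_eq less_SUP_iff by blast
  then obtain b where b: "a < ereal b" "b < payoff h c l (x, y)"
    \<comment> \<open>The level \<open>a\<close> may be \<open>- \<infinity>\<close>; an
      intermediate real \<open>b\<close> makes the density of the rationals in the reals
      applicable.\<close>
    using ereal_dense3[of a "ereal (payoff h c l (x, y))"] by auto
  then obtain q where "b < of_rat q" "of_rat q < payoff h c l (x, y)" using of_rat_dense by blast
  then show "\<exists>q\<in>{q::rat. a < ereal (of_rat q)}. x \<in> fst ` {z. of_rat q \<le> payoff h c l z}"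
    using b(1) by (intro bexI[of _ q] image_eqI[of _ _ "(x, y)"]) (auto intro: less_trans[of a "ereal b"])
next
  assume "\<exists>q\<in>{q::rat. a < ereal (of_rat q)}. x \<in> fst ` {z. of_rat q \<le> payoff h c l z}"
  then obtain q y where "a < ereal (of_rat q)" "of_rat q \<le> payoff h c l (x, y)" by auto
  then show "a < dual_potential h c l x" unfolding dual_potential_eq less_SUP_iff
    by (intro bexI[of _ y]) (auto intro: less_le_trans[of a])
qed

lemma dual_potential_measurable:
  fixes h :: "'a::polish_space \<Rightarrow> real" and c :: "'a \<times> 'a \<Rightarrow> real ^ 'n"
  assumes "usc (payoff h c l)"
  shows "dual_potential h c l \<in> borel_measurable univ_borel"
proof (rule borel_measurableI_greater)
  fix a
  have cl: "closed {z. of_rat q \<le> payoff h c l z}" for q :: rat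
    using assms by (rule closed_usc_superlevel)
  have "{x \<in> space univ_borel. a < dual_potential h c l x} =
      (\<Union>q\<in>{q::rat. a < ereal (of_rat q)}. fst ` {z. of_rat q \<le> payoff h c l z})"
    unfolding dual_potential_greater_iff by auto
  also have "\<dots> \<in> sets univ_borel"
  proof (rule sets.countable_UN'')
    fix q :: rat
    show "fst ` {z. of_rat q \<le> payoff h c l z} \<in> sets univ_borel"
      unfolding sets_univ_borel
    proof
      fix P :: "'a measure" assume "P \<in> borel_probs"
      then show "fst ` {z. of_rat q \<le> payoff h c l z} \<in> sets (completion P)"
        by (intro closed_projection_completion[OF cl]) (auto simp: borel_probs_def prob_space_def)
    qed
  qed simp
  finally show "{x \<in> space univ_borel. a < dual_potential h c l x} \<in> sets univ_borel" .
qed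

text \<open>The convex combination is realised as a Bernoulli choice between the two couplings.
  Integration against a monadic bind then gives the weighted sum of integrals, and the first
  marginal is kept because the weights add up to 1.\<close>

lemma mixture_coupling:
  fixes \<pi>1 \<pi>2 :: "('a::topological_space \<times> 'a) measure"
  assumes \<pi>: "\<pi>1 \<in> couplings_from Q" "\<pi>2 \<in> couplings_from Q" and w: "0 \<le> w" "w \<le> 1"
    and fst_meas: "fst \<in> borel_measurable (borel :: ('a \<times> 'a) measure)"
  obtains \<pi> where "\<pi> \<in> couplings_from Q"
    "\<And>f::'a \<times> 'a \<Rightarrow> real. integrable \<pi>1 f \<Longrightarrow> integrable \<pi>2 f \<Longrightarrow>
      integrable \<pi> f \<and> integral\<^sup>L \<pi> f = w * integral\<^sup>L \<pi>1 f + (1 - w) * integral\<^sup>L \<pi>2 f"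
proof -
  define K where "K b = (if b then \<pi>1 else \<pi>2)" for b
  define \<pi> where "\<pi> = measure_pmf (bernoulli_pmf w) \<bind> K"
  have s: "sets \<pi>1 = sets borel" "sets \<pi>2 = sets borel" and p: "prob_space \<pi>1" "prob_space \<pi>2"
    and d: "distr \<pi>1 borel fst = Q" "distr \<pi>2 borel fst = Q"
    using \<pi> by (auto simp: couplings_from_def borel_probs_def)
  have K: "K \<in> measurable (measure_pmf (bernoulli_pmf w)) (subprob_algebra borel)"
  proof -
    have "K b \<in> space (subprob_algebra borel)" for b
      using s p by (cases b) (simp_all add: K_def space_subprob_algebra prob_space_imp_subprob_space)
    then show ?thesis by simp
  qed
  have s\<pi>: "sets \<pi> = sets borel" unfolding \<pi>_def by (rule sets_bind_measurable[OF K]) simp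
  have p\<pi>: "prob_space \<pi>" unfolding \<pi>_def
    by (rule prob_space.prob_space_bind[OF prob_space_measure_pmf _ K]) (simp add: K_def p)
  have nn: "(\<integral>\<^sup>+z. f z \<partial>\<pi>) = (\<integral>\<^sup>+z. f z \<partial>\<pi>1) * ennreal w + (\<integral>\<^sup>+z. f z \<partial>\<pi>2) * ennreal (1 - w)"
    if "f \<in> borel_measurable borel" for f
    unfolding \<pi>_def by (subst nn_integral_bind[OF that K]) (use w in \<open>simp add: K_def\<close>)
  have meas: "fst \<in> measurable \<pi> borel" "fst \<in> measurable \<pi>1 borel" "fst \<in> measurable \<pi>2 borel"
    using fst_meas by (simp_all only: measurable_cong_sets[OF s\<pi> refl]
      measurable_cong_sets[OF s(1) refl] measurable_cong_sets[OF s(2) refl])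
  have "distr \<pi> borel fst = Q"
  proof (rule measure_eqI)
    show "sets (distr \<pi> borel fst) = sets Q" using d(1) by auto
    fix A assume "A \<in> sets (distr \<pi> borel fst)"
    then have A: "A \<in> sets borel" by simp
    have ind: "emeasure (distr \<rho> borel fst) A = (\<integral>\<^sup>+z. indicator A (fst z) \<partial>\<rho>)"
      if "fst \<in> measurable \<rho> borel" for \<rho> :: "('a \<times> 'a) measure"
      using nn_integral_distr[OF that, of "indicator A"] nn_integral_indicator[of A "distr \<rho> borel fst"] A
      by (simp only: sets_distr measurable_distr_eq1 borel_measurable_indicator)
    have "emeasure (distr \<pi> borel fst) A = emeasure (distr \<pi>1 borel fst) A * ennreal w + emeasure (distr \<pi>2 borel fst) A * ennreal (1 - w)"
      unfolding ind[OF meas(1)] ind[OF meas(2)] ind[OF meas(3)]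
      by (rule nn) (rule measurable_compose[OF fst_meas borel_measurable_indicator[OF A]])
    also have "\<dots> = emeasure Q A * ennreal w + emeasure Q A * ennreal (1 - w)"
      by (simp only: d)
    also have "\<dots> = emeasure Q A"
      using w by (simp flip: distrib_left ennreal_plus)
    finally show "emeasure (distr \<pi> borel fst) A = emeasure Q A" .
  qed
  then have "\<pi> \<in> couplings_from Q" using s\<pi> p\<pi> by (simp add: couplings_from_def borel_probs_def)
  moreover have "integrable \<pi> f \<and> integral\<^sup>L \<pi> f = w * integral\<^sup>L \<pi>1 f + (1 - w) * integral\<^sup>L \<pi>2 f"
    if f: "integrable \<pi>1 f" "integrable \<pi>2 f" for f :: "'a \<times> 'a \<Rightarrow> real"
  proof -
    have fb: "f \<in> borel_measurable borel"
      using borel_measurable_integrable[OF f(1)] by (simp only: measurable_cong_sets[OF s(1) refl])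
    have fin: "(\<integral>\<^sup>+z. ennreal (f z) \<partial>\<pi>1) \<noteq> \<infinity>" "(\<integral>\<^sup>+z. ennreal (- f z) \<partial>\<pi>1) \<noteq> \<infinity>"
      "(\<integral>\<^sup>+z. ennreal (f z) \<partial>\<pi>2) \<noteq> \<infinity>" "(\<integral>\<^sup>+z. ennreal (- f z) \<partial>\<pi>2) \<noteq> \<infinity>"
      using f by (auto simp: real_integrable_def)
    have n1: "(\<integral>\<^sup>+z. ennreal (f z) \<partial>\<pi>) = (\<integral>\<^sup>+z. ennreal (f z) \<partial>\<pi>1) * ennreal w + (\<integral>\<^sup>+z. ennreal (f z) \<partial>\<pi>2) * ennreal (1 - w)"
     and n2: "(\<integral>\<^sup>+z. ennreal (- f z) \<partial>\<pi>) = (\<integral>\<^sup>+z. ennreal (- f z) \<partial>\<pi>1) * ennreal w + (\<integral>\<^sup>+z. ennreal (- f z) \<partial>\<pi>2) * ennreal (1 - w)"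
      using fb by (auto intro!: nn)
    have i: "integrable \<pi> f"
      unfolding real_integrable_def n1 n2 using fin fb
      by (simp add: measurable_cong_sets[OF s\<pi> refl] ennreal_mult_eq_top_iff)
    have "integral\<^sup>L \<pi> f = w * integral\<^sup>L \<pi>1 f + (1 - w) * integral\<^sup>L \<pi>2 f"
      unfolding real_lebesgue_integral_def[OF i] real_lebesgue_integral_def[OF f(1)] real_lebesgue_integral_def[OF f(2)] n1 n2
      using fin w
      by (subst (1 2) enn2real_plus) (auto simp: enn2real_mult ennreal_mult_less_top less_top algebra_simps)
    with i show ?thesis by simp
  qed
  ultimately show thesis by (rule that)
qed

section \<open>Inequalities between positive and negative parts\<close>

text \<open>This is \<open>a \<le> y + b\<close> with each negative part moved to the opposite side.
  In this form it can be integrated in the nonnegative extended reals without meeting \<infinity> -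
  \<infinity>.\<close>

lemma ennreal_slack_bound:
  fixes y :: ereal
  assumes "ereal (a - b) \<le> y" "0 \<le> b"
  shows "ennreal a + e2ennreal (- y) \<le> e2ennreal y + ennreal b + ennreal (- a)"
proof (cases y)
  case (real r)
  then have r: "a - b \<le> r" using assms(1) by simp
  have e: "ennreal x = ennreal (max 0 x)" for x by (cases "0 \<le> x") (simp_all add: ennreal_neg)
  have "ennreal a + ennreal (- r) = ennreal (max 0 a + max 0 (- r))"
    by (subst e[of a], subst e[of "- r"]) simp
  also have "\<dots> \<le> ennreal (max 0 r + b + max 0 (- a))"
    using r assms(2) by (intro ennreal_leI) linarith
  also have "\<dots> = ennreal r + ennreal b + ennreal (- a)"
    using assms(2) by (subst e[of r], subst e[of "- a"]) simp
  finally show ?thesis using real by simp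
qed (use assms in simp_all)

text \<open>Undoes that rearrangement after integration: \<open>A\<close>, \<open>D\<close> stand
  for the parts of the reward, \<open>C\<close>, \<open>B\<close> for those of the dual function. An
  infinite \<open>C\<close> makes the right side \<infinity>, an infinite \<open>D\<close> forces
  \<open>A\<close> finite and the left side to be -\<infinity>, and otherwise all terms are
  finite.\<close>

lemma enn2ereal_diff_bound:
  assumes "A + B \<le> C + ennreal e + D" "0 \<le> e" "B < \<infinity>" "A < \<infinity> \<or> D < \<infinity>"
  shows "enn2ereal A - enn2ereal D \<le> ereal e + (enn2ereal C - enn2ereal B)"
proof (cases C)
  case top
  then show ?thesis using assms(3) by (cases B) (simp_all add: enn2ereal_ennreal)
next
  case C: (real x)
  obtain b where B: "0 \<le> b" "B = ennreal b" using assms(3) by (cases B) simp_all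
  show ?thesis
  proof (cases D)
    case top
    then show ?thesis using assms(4) by (cases A) (simp_all add: enn2ereal_ennreal)
  next
    case D: (real d)
    have "A < \<infinity>"
    proof -
      have "A \<le> A + B" by simp
      also have "\<dots> \<le> C + ennreal e + D" by fact
      also have "\<dots> < \<infinity>" by (simp add: C D)
      finally show ?thesis .
    qed
    then obtain a where A: "0 \<le> a" "A = ennreal a" by (cases A) simp_all
    have "ennreal (a + b) \<le> ennreal (x + e + d)"
      using assms(1,2) A B C D by simp
    then have "a + b \<le> x + e + d" using assms(2) C D by (subst (asm) ennreal_le_iff) simp_all
    then show ?thesis using A B C D by (simp add: enn2ereal_ennreal)
  qed
qed

subsection \<open>The transport problem\<close>

locale transport_problem =
  fixes Q :: "'a::polish_space measure" and h :: "'a \<Rightarrow> real" and c :: "'a \<times> 'a \<Rightarrow> real ^ 'n"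
  assumes Q: "Q \<in> borel_probs"
    and h_usc: "usc h"
    and h_int: "integrable Q h"
    and c_nonneg: "\<And>k z. 0 \<le> c z $ k"
    and c_lsc: "\<And>k. lsc (\<lambda>z. c z $ k)"
    and c_diag: "\<And>k \<zeta>. c (\<zeta>, \<zeta>) $ k = 0"
begin

lemma sets_Q [simp, measurable_cong]: "sets Q = sets borel"
  using Q by (simp add: borel_probs_def)

lemma prob_space_Q: "prob_space Q"
  using Q by (simp add: borel_probs_def)

lemma space_Q [simp]: "space Q = UNIV"
  using sets_eq_imp_space_eq[OF sets_Q] by simp

lemma h_measurable [measurable]: "h \<in> borel_measurable borel"
  by (rule usc_borel_measurable[OF h_usc])

lemma c_measurable [measurable]: "(\<lambda>z. c z $ k) \<in> borel_measurable (borel \<Otimes>\<^sub>M borel)"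
  using lsc_borel_measurable[OF c_lsc] by (simp only: borel_prod)

lemma payoff_measurable [measurable]: "payoff h c l \<in> borel_measurable (borel \<Otimes>\<^sub>M borel)"
  unfolding payoff_def[abs_def] inner_vec_def inner_real_def by measurable

section \<open>Transport maps with integrable reward and costs\<close>

text \<open>Exactly the integrability that lets the payoff along the graph of \<open>s\<close> be
  split into reward and weighted costs, and that makes the graph coupling eligible in
  \<open>multiplier_exists\<close>.\<close>

definition tame :: "('a \<Rightarrow> 'a) \<Rightarrow> bool" where
  "tame s \<longleftrightarrow> s \<in> borel_measurable borel \<and> integrable Q (\<lambda>x. h (s x)) \<and>
     (\<forall>k. integrable Q (\<lambda>x. c (x, s x) $ k))"

lemma tame_id: "tame (\<lambda>x. x)"
  using h_int by (simp add: tame_def c_diag)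

lemma tame_If:
  assumes "tame s" "tame t" and [measurable]: "Measurable.pred borel P"
  shows "tame (\<lambda>x. if P x then s x else t x)"
proof -
  have [measurable]: "s \<in> borel_measurable borel" "t \<in> borel_measurable borel"
    using assms by (simp_all add: tame_def)
  have "integrable Q (\<lambda>x. h (if P x then s x else t x))"
  proof (rule Bochner_Integration.integrable_bound)
    show "integrable Q (\<lambda>x. \<bar>h (s x)\<bar> + \<bar>h (t x)\<bar>)"
      using assms by (intro Bochner_Integration.integrable_add integrable_abs) (simp_all add: tame_def)
  qed (simp_all, measurable)
  moreover have "integrable Q (\<lambda>x. c (x, if P x then s x else t x) $ k)" for k
  proof (rule Bochner_Integration.integrable_bound)
    show "integrable Q (\<lambda>x. \<bar>c (x, s x) $ k\<bar> + \<bar>c (x, t x) $ k\<bar>)"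
      using assms by (intro Bochner_Integration.integrable_add integrable_abs) (simp_all add: tame_def)
  qed (simp_all, measurable)
  ultimately show ?thesis unfolding tame_def by simp
qed

text \<open>Where \<open>s\<close> moves a point, reward and costs are bounded by \<open>B\<close>;
  where it does not, the costs vanish and the reward is \<open>h x\<close>. So a constant plus
  \<open>\<bar>h x\<bar>\<close> dominates.\<close>

lemma tame_truncate:
  assumes [measurable]: "s \<in> borel_measurable borel"
    and bd: "\<And>x. s x \<noteq> x \<Longrightarrow> \<bar>h (s x)\<bar> \<le> B \<and> (\<forall>k. c (x, s x) $ k \<le> B)"
  shows "tame s"
proof -
  interpret prob_space Q by (rule prob_space_Q)
  have "integrable Q (\<lambda>x. h (s x))"
  proof (rule Bochner_Integration.integrable_bound)
    show "integrable Q (\<lambda>x. \<bar>B\<bar> + \<bar>h x\<bar>)"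
      using h_int by (intro Bochner_Integration.integrable_add integrable_abs integrable_const)
    have "\<bar>h (s x)\<bar> \<le> \<bar>B\<bar> + \<bar>h x\<bar>" for x
      using bd[of x] by (cases "s x = x") auto
    then show "AE x in Q. norm (h (s x)) \<le> norm (\<bar>B\<bar> + \<bar>h x\<bar>)" by simp
  qed measurable
  moreover have "integrable Q (\<lambda>x. c (x, s x) $ k)" for k
  proof (rule Bochner_Integration.integrable_bound)
    show "integrable Q (\<lambda>x. \<bar>B\<bar>)" by (rule integrable_const)
    have "\<bar>c (x, s x) $ k\<bar> \<le> \<bar>B\<bar>" for x
      using bd[of x] c_nonneg[of "(x, s x)" k] by (cases "s x = x") (auto simp: c_diag)
    then show "AE x in Q. norm (c (x, s x) $ k) \<le> norm \<bar>B\<bar>" by simp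
  qed measurable
  ultimately show ?thesis unfolding tame_def by simp
qed

lemma integrable_payoff:
  assumes "tame s"
  shows "integrable Q (\<lambda>x. payoff h c l (x, s x))"
  unfolding payoff_def inner_vec_def inner_real_def using assms
  by (auto simp: tame_def)

lemma graph_coupling:
  assumes "tame s"
  defines "\<pi> \<equiv> distr Q borel (\<lambda>x. (x, s x))"
  shows "\<pi> \<in> couplings_from Q"
    "integrable \<pi> (\<lambda>z. h (snd z))" "\<And>k. integrable \<pi> (\<lambda>z. c z $ k)"
    "integral\<^sup>L \<pi> (\<lambda>z. h (snd z)) = (\<integral>x. h (s x) \<partial>Q)"
    "\<And>k. integral\<^sup>L \<pi> (\<lambda>z. c z $ k) = (\<integral>x. c (x, s x) $ k \<partial>Q)"
proof -
  have [measurable]: "s \<in> borel_measurable borel" using assms by (simp add: tame_def)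
  have g: "(\<lambda>x. (x, s x)) \<in> measurable Q borel"
    unfolding borel_prod[symmetric] by measurable
  have f: "fst \<in> measurable (borel :: ('a \<times> 'a) measure) borel"
    unfolding borel_prod[symmetric] by measurable
  have hm: "(\<lambda>z. h (snd z)) \<in> borel_measurable (borel :: ('a \<times> 'a) measure)"
    unfolding borel_prod[symmetric] by measurable
  have cm: "(\<lambda>z. c z $ k) \<in> borel_measurable borel" for k
    by (rule lsc_borel_measurable[OF c_lsc])
  have "distr \<pi> borel fst = distr Q borel (\<lambda>x. x)"
    unfolding \<pi>_def by (subst distr_distr[OF f g]) (simp add: o_def)
  also have "\<dots> = Q" by (rule distr_id2) simp
  finally have "distr \<pi> borel fst = Q" .
  moreover have "prob_space \<pi>" unfolding \<pi>_def by (rule prob_space.prob_space_distr[OF prob_space_Q g])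
  ultimately show "\<pi> \<in> couplings_from Q"
    by (simp add: couplings_from_def borel_probs_def \<pi>_def)
  show "integrable \<pi> (\<lambda>z. h (snd z))" "\<And>k. integrable \<pi> (\<lambda>z. c z $ k)"
    unfolding \<pi>_def using assms(1) by (simp_all add: integrable_distr_eq[OF g hm] integrable_distr_eq[OF g cm] tame_def)
  show "integral\<^sup>L \<pi> (\<lambda>z. h (snd z)) = (\<integral>x. h (s x) \<partial>Q)"
    unfolding \<pi>_def by (simp add: integral_distr[OF g hm])
  show "integral\<^sup>L \<pi> (\<lambda>z. c z $ k) = (\<integral>x. c (x, s x) $ k \<partial>Q)" for k
    unfolding \<pi>_def by (simp add: integral_distr[OF g cm])
qed

lemma payoff_diag: "payoff h c l (x, x) = h x"
  by (simp add: payoff_def inner_vec_def c_diag)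

text \<open>\<^const>\<open>dual_potential\<close> is a countable supremum along truncated selections of the rational
  superlevel sets, and a running maximum makes it an increasing limit along tame maps.\<close>

lemma dual_potential_tame_approx:
  assumes l: "\<And>k. 0 \<le> l $ k"
  obtains m where "\<And>n::nat. tame (m n)" "\<And>x. m 0 x = x"
    "\<And>x. incseq (\<lambda>n. payoff h c l (x, m n x))"
    "AE x in Q. dual_potential h c l x = (SUP n. ereal (payoff h c l (x, m n x)))"
proof -
  interpret prob_space Q by (rule prob_space_Q)
  let ?C = "\<lambda>q::rat. {z. of_rat q \<le> payoff h c l z}"
  have cl: "closed (?C q)" for q
    by (rule closed_usc_superlevel[OF usc_payoff[OF h_usc c_lsc l]])
  have "\<forall>q. \<exists>s. s \<in> borel_measurable borel \<and>
      (\<exists>N. N \<in> null_sets Q \<and> (\<forall>x. x \<in> fst ` ?C q \<longrightarrow> x \<notin> N \<longrightarrow> (x, s x) \<in> ?C q))"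
  proof
    fix q
    show "\<exists>s. s \<in> borel_measurable borel \<and>
      (\<exists>N. N \<in> null_sets Q \<and> (\<forall>x. x \<in> fst ` ?C q \<longrightarrow> x \<notin> N \<longrightarrow> (x, s x) \<in> ?C q))"
    proof (rule closed_selection[OF cl[of q] sets_Q finite_measure_axioms])
      fix s N assume "s \<in> borel_measurable borel" "N \<in> null_sets Q"
        and "\<And>x. x \<in> fst ` ?C q \<Longrightarrow> x \<notin> N \<Longrightarrow> (x, s x) \<in> ?C q"
      then show ?thesis by (intro exI[of _ s] exI[of _ N] conjI allI impI)
    qed
  qed
  from choice[OF this] obtain s where
    s: "\<forall>q. s q \<in> borel_measurable borel \<and>
      (\<exists>N. N \<in> null_sets Q \<and> (\<forall>x. x \<in> fst ` ?C q \<longrightarrow> x \<notin> N \<longrightarrow> (x, s q x) \<in> ?C q))"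
    by (rule exE)
  then have s_meas [measurable]: "s q \<in> borel_measurable borel" for q by simp
  from s have "\<forall>q. \<exists>N. N \<in> null_sets Q \<and> (\<forall>x. x \<in> fst ` ?C q \<longrightarrow> x \<notin> N \<longrightarrow> (x, s q x) \<in> ?C q)"
    by simp
  from choice[OF this] obtain N where
    N: "\<forall>q. N q \<in> null_sets Q \<and> (\<forall>x. x \<in> fst ` ?C q \<longrightarrow> x \<notin> N q \<longrightarrow> (x, s q x) \<in> ?C q)"
    by (rule exE)
  \<comment> \<open>Each \<open>G (q, M)\<close> is tame by truncation, and at every fixed
    \<open>x\<close> the truncation is inactive once \<open>M\<close> is large. Pairs keep the
    family countable.\<close>
  define G where "G qM x = (case qM of (q, M :: nat) \<Rightarrow>
      if \<bar>h (s q x)\<bar> \<le> real M \<and> (\<forall>k. c (x, s q x) $ k \<le> real M) then s q x else x)" for qM x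
  have G_tame: "tame (G qM)" for qM
  proof -
    obtain q M where qM: "qM = (q, M)" by (cases qM)
    show ?thesis
    proof (rule tame_truncate[where B = "real M"])
      show "G qM \<in> borel_measurable borel" unfolding G_def[abs_def] qM prod.case by measurable
      show "G qM x \<noteq> x \<Longrightarrow> \<bar>h (G qM x)\<bar> \<le> real M \<and> (\<forall>k. c (x, G qM x) $ k \<le> real M)" for x
        unfolding G_def qM prod.case by (simp split: if_split_asm)
    qed
  qed
  define g where "g n = G (from_nat n)" for n
  \<comment> \<open>Step \<open>n\<close> switches to \<open>g n\<close> only where this improves
    the payoff. Each \<open>m n\<close> uses finitely many switches and so stays tame, and starting
    from the identity keeps all payoffs above \<open>h\<close>.\<close>
  define m where "m = rec_nat (\<lambda>x. x)
    (\<lambda>n f x. if payoff h c l (x, f x) < payoff h c l (x, g n x) then g n x else f x)"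
  have m0: "m 0 = (\<lambda>x. x)" and mS: "\<And>n. m (Suc n) =
      (\<lambda>x. if payoff h c l (x, m n x) < payoff h c l (x, g n x) then g n x else m n x)"
    unfolding m_def by simp_all
  have m_tame: "tame (m n)" for n
  proof (induction n)
    case 0
    then show ?case unfolding m0 by (rule tame_id)
  next
    case (Suc n)
    have [measurable]: "m n \<in> borel_measurable borel" "g n \<in> borel_measurable borel"
      using Suc G_tame[of "from_nat n"] by (simp_all add: tame_def g_def)
    show ?case unfolding mS
      by (rule tame_If[OF G_tame[of "from_nat n", folded g_def] Suc]) measurable
  qed
  have m_ge: "payoff h c l (x, g n x) \<le> payoff h c l (x, m (Suc n) x)"
    and m_step: "payoff h c l (x, m n x) \<le> payoff h c l (x, m (Suc n) x)" for n x
    unfolding mS by simp_all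
  have "AE x in Q. \<forall>q. x \<notin> N q"
    using N by (subst AE_all_countable) (auto intro: AE_not_in)
  then have "AE x in Q. dual_potential h c l x = (SUP n. ereal (payoff h c l (x, m n x)))"
  proof (rule AE_mp, intro AE_I2 impI)
    fix x assume x: "\<forall>q. x \<notin> N q"
    show "dual_potential h c l x = (SUP n. ereal (payoff h c l (x, m n x)))"
    proof (rule antisym)
      show "(SUP n. ereal (payoff h c l (x, m n x))) \<le> dual_potential h c l x"
        unfolding dual_potential_eq by (intro SUP_least SUP_upper UNIV_I)
      show "dual_potential h c l x \<le> (SUP n. ereal (payoff h c l (x, m n x)))"
      proof (rule dense_le)
        fix a assume "a < dual_potential h c l x"
        then obtain q where q: "a < ereal (of_rat q)" "x \<in> fst ` ?C q"
          unfolding dual_potential_greater_iff by (elim bexE) simp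
        then have hit: "of_rat q \<le> payoff h c l (x, s q x)" using N x by simp
        \<comment> \<open>The sum bounds all the nonnegative costs at once, so this one
          \<open>M\<close> deactivates the truncation at \<open>x\<close>.\<close>
        define M where "M = nat \<lceil>\<bar>h (s q x)\<bar> + (\<Sum>k\<in>UNIV. c (x, s q x) $ k)\<rceil>"
        have "\<bar>h (s q x)\<bar> + (\<Sum>k\<in>UNIV. c (x, s q x) $ k) \<le> real M"
          unfolding M_def by linarith
        moreover have "0 \<le> (\<Sum>k\<in>UNIV. c (x, s q x) $ k)" by (intro sum_nonneg c_nonneg)
        moreover have "c (x, s q x) $ k \<le> (\<Sum>k\<in>UNIV. c (x, s q x) $ k)" for k
          by (rule member_le_sum) (simp_all add: c_nonneg)
        ultimately have "\<bar>h (s q x)\<bar> \<le> real M \<and> (\<forall>k. c (x, s q x) $ k \<le> real M)"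
          by (smt (verit))
        then have "g (to_nat (q, M)) x = s q x" by (simp add: g_def G_def)
        then have "of_rat q \<le> payoff h c l (x, m (Suc (to_nat (q, M))) x)"
          using hit m_ge[of x "to_nat (q, M)"] by simp
        then have "ereal (of_rat q) \<le> (SUP n. ereal (payoff h c l (x, m n x)))"
          by (intro SUP_upper2[OF UNIV_I]) simp
        with q(1) show "a \<le> (SUP n. ereal (payoff h c l (x, m n x)))"
          by (meson less_imp_le less_le_trans)
      qed
    qed
  qed
  moreover have "incseq (\<lambda>n. payoff h c l (x, m n x))" for x
    by (rule incseq_SucI) (rule m_step)
  ultimately show thesis using m_tame m0 by (intro that) simp_all
qed

text \<open>The payoffs along the tame maps increase to the potential and start at the integrable
  \<open>h\<close>, so monotone convergence carries the uniform bound \<open>B\<close> to the limit.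
  The work lies in showing that the limit is finite almost everywhere, as the potential may take the
  value \<infinity>.\<close>

lemma integral_dual_potential_le:
  assumes l: "\<And>k. 0 \<le> l $ k"
    and B: "\<And>s. tame s \<Longrightarrow> (\<integral>x. payoff h c l (x, s x) \<partial>Q) \<le> B"
  shows "ext_integral (completion Q) (dual_potential h c l) \<le> ereal B"
proof (rule dual_potential_tame_approx[OF l])
  fix m
  assume m: "\<And>n::nat. tame (m n)" "\<And>x. m 0 x = x"
    "\<And>x. incseq (\<lambda>n. payoff h c l (x, m n x))"
    "AE x in Q. dual_potential h c l x = (SUP n. ereal (payoff h c l (x, m n x)))"
  define f where "f n x = payoff h c l (x, m n x)" for n x
  have f_int: "integrable Q (f n)" for n
    unfolding f_def[abs_def] by (rule integrable_payoff[OF m(1)])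
  then have [measurable]: "f n \<in> borel_measurable Q" for n by (rule borel_measurable_integrable)
  have f_le: "integral\<^sup>L Q (f n) \<le> B" for n
    unfolding f_def[abs_def] by (rule B[OF m(1)])
  have f_mono: "f i x \<le> f j x" if "i \<le> j" for i j x
    using incseqD[OF m(3) that] by (simp only: f_def)
  have f_0: "f 0 x = h x" for x by (simp only: f_def m(2) payoff_diag)
  have h_le: "h x \<le> f n x" for n x using f_mono[of 0 n x] by (simp add: f_0)
  \<comment> \<open>Subtracting \<open>h\<close> makes the sequence nonnegative; the supremum then
    has finite integral and is finite almost everywhere.\<close>
  have "(\<integral>\<^sup>+x. (SUP n. ennreal (f n x - h x)) \<partial>Q) = (SUP n. \<integral>\<^sup>+x. ennreal (f n x - h x) \<partial>Q)"
  proof (rule nn_integral_monotone_convergence_SUP)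
    show "incseq (\<lambda>n x. ennreal (f n x - h x))"
      by (intro incseq_SucI le_funI ennreal_leI diff_right_mono f_mono) simp
  qed measurable
  also have "\<dots> \<le> ennreal (B - integral\<^sup>L Q h)"
  proof (rule SUP_least)
    fix n
    have "(\<integral>\<^sup>+x. ennreal (f n x - h x) \<partial>Q) = ennreal (\<integral>x. f n x - h x \<partial>Q)"
      using f_int h_int h_le by (intro nn_integral_eq_integral Bochner_Integration.integrable_diff AE_I2) simp_all
    also have "\<dots> \<le> ennreal (B - integral\<^sup>L Q h)"
      using f_int h_int f_le by (intro ennreal_leI) simp
    finally show "(\<integral>\<^sup>+x. ennreal (f n x - h x) \<partial>Q) \<le> ennreal (B - integral\<^sup>L Q h)" .
  qed
  finally have le: "(\<integral>\<^sup>+x. (SUP n. ennreal (f n x - h x)) \<partial>Q) \<le> ennreal (B - integral\<^sup>L Q h)" .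
  have "(\<integral>\<^sup>+x. (SUP n. ennreal (f n x - h x)) \<partial>Q) < \<infinity>"
    using le by (rule le_less_trans) simp
  then have "AE x in Q. (SUP n. ennreal (f n x - h x)) \<noteq> \<infinity>"
    by (intro nn_integral_noteq_infinite) simp_all
  then have fin: "AE x in Q. \<bar>SUP n. ereal (f n x)\<bar> \<noteq> \<infinity>"
  proof (rule AE_mp, intro AE_I2 impI)
    fix x assume "(SUP n. ennreal (f n x - h x)) \<noteq> \<infinity>"
    then obtain r where r: "0 \<le> r" "(SUP n. ennreal (f n x - h x)) = ennreal r"
      by (cases "SUP n. ennreal (f n x - h x)") simp_all
    have "f n x \<le> h x + r" for n
    proof -
      have "ennreal (f n x - h x) \<le> ennreal r" unfolding r(2)[symmetric] by (rule SUP_upper) simp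
      then have "f n x - h x \<le> r" using r(1) by simp
      then show ?thesis by simp
    qed
    then have "(SUP n. ereal (f n x)) \<le> ereal (h x + r)" by (intro SUP_least) simp
    moreover have "ereal (f 0 x) \<le> (SUP n. ereal (f n x))" by (rule SUP_upper) simp
    ultimately show "\<bar>SUP n. ereal (f n x)\<bar> \<noteq> \<infinity>" by (cases "SUP n. ereal (f n x)") simp_all
  qed
  \<comment> \<open>A real-valued \<open>Q\<close>-measurable version of the potential, equal to it
    almost everywhere.\<close>
  define F where "F x = real_of_ereal (SUP n. ereal (f n x))" for x
  have [measurable]: "F \<in> borel_measurable Q" unfolding F_def[abs_def] by measurable
  have lim: "AE x in Q. (\<lambda>n. f n x) \<longlonglongrightarrow> F x"
    using fin
  proof (rule AE_mp, intro AE_I2 impI)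
    fix x assume "\<bar>SUP n. ereal (f n x)\<bar> \<noteq> \<infinity>"
    then have "ereal (F x) = (SUP n. ereal (f n x))" unfolding F_def by (rule ereal_real')
    moreover have "(\<lambda>n. ereal (f n x)) \<longlonglongrightarrow> (SUP n. ereal (f n x))"
      by (rule LIMSEQ_SUP) (simp add: incseq_def f_mono)
    ultimately show "(\<lambda>n. f n x) \<longlonglongrightarrow> F x" by (simp add: lim_ereal[symmetric])
  qed
  have "incseq (\<lambda>n. integral\<^sup>L Q (f n))"
    by (intro incseq_SucI integral_mono f_int f_mono) simp
  then obtain L where L: "(\<lambda>n. integral\<^sup>L Q (f n)) \<longlonglongrightarrow> L"
    using incseq_convergent[of "\<lambda>n. integral\<^sup>L Q (f n)" B] f_le by metis
  have mono_ae: "AE x in Q. mono (\<lambda>n. f n x)" by (intro AE_I2 monoI f_mono)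
  have F_int: "integrable Q F"
    by (rule integrable_monotone_convergence[OF f_int mono_ae lim L]) simp
  have "integral\<^sup>L Q F = L"
    by (rule integral_monotone_convergence[OF f_int mono_ae lim L]) simp
  also have "L \<le> B" by (rule LIMSEQ_le_const2[OF L]) (simp add: f_le)
  finally have FB: "integral\<^sup>L Q F \<le> B" .
  have ae: "AE x in Q. dual_potential h c l x = ereal (F x)"
    using m(4) fin by eventually_elim (simp add: F_def f_def ereal_real')
  have "ext_integral (completion Q) (dual_potential h c l) = ext_integral Q (\<lambda>x. ereal (F x))"
  proof -
    have "(\<integral>\<^sup>+x. e2ennreal (dual_potential h c l x) \<partial>Q) = (\<integral>\<^sup>+x. e2ennreal (ereal (F x)) \<partial>Q)"
      by (rule nn_integral_cong_AE) (use ae in eventually_elim, simp)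
    moreover have "(\<integral>\<^sup>+x. e2ennreal (- dual_potential h c l x) \<partial>Q) = (\<integral>\<^sup>+x. e2ennreal (- ereal (F x)) \<partial>Q)"
      by (rule nn_integral_cong_AE) (use ae in eventually_elim, simp)
    ultimately show ?thesis unfolding ext_integral_def nn_integral_completion by simp
  qed
  also have "\<dots> = ereal (integral\<^sup>L Q F)" by (rule ext_integral_integrable[OF F_int])
  finally show ?thesis using FB by simp
qed

section \<open>Separation and the Lagrange multiplier\<close>

text \<open>Only couplings with integrable reward and costs enter, so the attainable pairs are real
  vectors and Euclidean separation applies without any topology on the space of couplings.\<close>

lemma multiplier_exists:
  assumes eps: "\<And>k. 0 < \<epsilon> $ k"
    and v: "\<And>\<pi>. \<pi> \<in> couplings_from Q \<Longrightarrow> integrable \<pi> (\<lambda>z. h (snd z)) \<Longrightarrow>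
      (\<And>k. integrable \<pi> (\<lambda>z. c z $ k)) \<Longrightarrow> (\<And>k. integral\<^sup>L \<pi> (\<lambda>z. c z $ k) \<le> \<epsilon> $ k) \<Longrightarrow>
      integral\<^sup>L \<pi> (\<lambda>z. h (snd z)) \<le> v"
  obtains l where "\<And>k. 0 \<le> l $ k"
    "\<And>\<pi>. \<pi> \<in> couplings_from Q \<Longrightarrow> integrable \<pi> (\<lambda>z. h (snd z)) \<Longrightarrow>
      (\<And>k. integrable \<pi> (\<lambda>z. c z $ k)) \<Longrightarrow>
      integral\<^sup>L \<pi> (\<lambda>z. h (snd z)) - (\<Sum>k\<in>UNIV. l $ k * integral\<^sup>L \<pi> (\<lambda>z. c z $ k)) \<le> v - l \<bullet> \<epsilon>"
proof -
  define adm where "adm \<pi> \<longleftrightarrow> \<pi> \<in> couplings_from Q \<and> integrable \<pi> (\<lambda>z. h (snd z)) \<and>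
    (\<forall>k. integrable \<pi> (\<lambda>z. c z $ k))" for \<pi>
  define H where "H \<pi> = integral\<^sup>L \<pi> (\<lambda>z. h (snd z))" for \<pi> :: "('a \<times> 'a) measure"
  define J where "J \<pi> k = integral\<^sup>L \<pi> (\<lambda>z. c z $ k)" for \<pi> k
  \<comment> \<open>Strictness in the reward keeps \<open>(v, \<epsilon>)\<close> outside
    \<open>S\<close> even if the value is attained. The enlargement in the reward and cost
    directions will fix the signs of the normal vector.\<close>
  define S where "S = {p :: real \<times> (real ^ 'n). \<exists>\<pi>. adm \<pi> \<and> fst p < H \<pi> \<and> (\<forall>k. J \<pi> k \<le> snd p $ k)}"
  have S_I: "(r, u) \<in> S" if "adm \<pi>" "r < H \<pi>" "\<And>k. J \<pi> k \<le> u $ k" for r u \<pi>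
    unfolding S_def using that by auto
  define \<pi>0 where "\<pi>0 = distr Q borel (\<lambda>x. (x, x))"
  have \<pi>0: "adm \<pi>0" "\<And>k. J \<pi>0 k = 0"
    using graph_coupling[OF tame_id] unfolding adm_def J_def \<pi>0_def by (simp_all add: c_diag)
  have fst_meas: "fst \<in> borel_measurable (borel :: ('a \<times> 'a) measure)"
    unfolding borel_prod[symmetric] by measurable
  have "convex S"
  proof (rule convexI)
    fix p q :: "real \<times> (real ^ 'n)" and a b :: real
    assume pS: "p \<in> S" and qS: "q \<in> S" and ab: "0 \<le> a" "0 \<le> b" "a + b = 1"
    from pS obtain \<pi>1 where \<pi>1: "adm \<pi>1" "fst p < H \<pi>1" "\<And>k. J \<pi>1 k \<le> snd p $ k"
      unfolding S_def by auto
    from qS obtain \<pi>2 where \<pi>2: "adm \<pi>2" "fst q < H \<pi>2" "\<And>k. J \<pi>2 k \<le> snd q $ k"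
      unfolding S_def by auto
    have b: "1 - a = b" using ab by simp
    have *: "\<pi>1 \<in> couplings_from Q" "\<pi>2 \<in> couplings_from Q" "a \<le> 1"
      using \<pi>1(1) \<pi>2(1) ab by (simp_all add: adm_def)
    show "a *\<^sub>R p + b *\<^sub>R q \<in> S"
    proof (rule mixture_coupling[OF *(1,2) ab(1) *(3) fst_meas], unfold b)
      fix \<pi> assume \<pi>: "\<pi> \<in> couplings_from Q"
        and mix: "\<And>f::'a \<times> 'a \<Rightarrow> real. integrable \<pi>1 f \<Longrightarrow> integrable \<pi>2 f \<Longrightarrow>
          integrable \<pi> f \<and> integral\<^sup>L \<pi> f = a * integral\<^sup>L \<pi>1 f + b * integral\<^sup>L \<pi>2 f"
      have mixh: "integrable \<pi> (\<lambda>z. h (snd z)) \<and> H \<pi> = a * H \<pi>1 + b * H \<pi>2"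
        unfolding H_def using \<pi>1(1) \<pi>2(1) by (intro mix) (simp_all add: adm_def)
      have mixc: "integrable \<pi> (\<lambda>z. c z $ k) \<and> J \<pi> k = a * J \<pi>1 k + b * J \<pi>2 k" for k
        unfolding J_def using \<pi>1(1) \<pi>2(1) by (intro mix) (simp_all add: adm_def)
      have "(a * fst p + b * fst q, a *\<^sub>R snd p + b *\<^sub>R snd q) \<in> S"
      proof (rule S_I)
        show "adm \<pi>" using \<pi> mixh mixc by (simp add: adm_def)
        show "a * fst p + b * fst q < H \<pi>"
        \<comment> \<open>Strictness survives only in a summand with positive weight: the second one
          if \<open>a = 0\<close>, else the first.\<close>
        proof (cases "a = 0")
          case True
          then show ?thesis using mixh ab \<pi>2(2) by simp
        next
          case False
          then have "a * fst p < a * H \<pi>1" using ab(1) \<pi>1(2) by simp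
          moreover have "b * fst q \<le> b * H \<pi>2" using ab(2) \<pi>2(2) by (simp add: mult_left_mono)
          ultimately show ?thesis using mixh by linarith
        qed
        show "J \<pi> k \<le> (a *\<^sub>R snd p + b *\<^sub>R snd q) $ k" for k
          using mixc[of k] mult_left_mono[OF \<pi>1(3) ab(1)] mult_left_mono[OF \<pi>2(3) ab(2)]
          by (simp add: add_mono)
      qed
      moreover have "a *\<^sub>R p + b *\<^sub>R q = (a * fst p + b * fst q, a *\<^sub>R snd p + b *\<^sub>R snd q)"
        by (simp add: prod_eq_iff)
      ultimately show ?thesis by (simp only:)
    qed
  qed
  moreover have "(H \<pi>0 - 1, 0) \<in> S" by (rule S_I[OF \<pi>0(1)]) (simp_all add: \<pi>0(2))
  then have "S \<noteq> {}" by blast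
  moreover have "S \<inter> {(v, \<epsilon>)} = {}"
  proof -
    have False if "(v, \<epsilon>) \<in> S"
    proof -
      from that obtain \<pi> where \<pi>: "adm \<pi>" "v < H \<pi>" "\<And>k. J \<pi> k \<le> \<epsilon> $ k" unfolding S_def by auto
      have "H \<pi> \<le> v" unfolding H_def
        using \<pi>(1,3) by (intro v) (simp_all add: adm_def J_def)
      then show False using \<pi>(2) by simp
    qed
    then show ?thesis by auto
  qed
  ultimately obtain n \<beta> where n: "n \<noteq> 0" "\<forall>p\<in>S. n \<bullet> p \<le> \<beta>" "\<forall>p\<in>{(v, \<epsilon>)}. \<beta> \<le> n \<bullet> p"
    using separating_hyperplane_sets[of S "{(v, \<epsilon>)}"] by auto
  obtain \<alpha> w where nw: "n = (\<alpha>, w)" by (cases n)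
  define K where "K = \<alpha> * v + w \<bullet> \<epsilon>"
  have sep: "\<alpha> * r + w \<bullet> u \<le> K" if "(r, u) \<in> S" for r u
    using bspec[OF n(2) that] n(3) by (simp add: nw K_def)
  have zero: "\<alpha> * r \<le> K" if "r < H \<pi>0" for r
    using sep[OF S_I[OF \<pi>0(1) that, of 0]] \<pi>0(2) by simp
  have \<alpha>0: "0 \<le> \<alpha>"
  proof (rule ccontr)
    assume "\<not> 0 \<le> \<alpha>"
    then have neg: "\<alpha> < 0" by simp
    \<comment> \<open>Rewards in \<open>S\<close> are unbounded below. This \<open>r\<close> makes
      \<open>\<alpha> * r\<close> at least \<open>K + 1\<close> for negative
      \<open>\<alpha>\<close>, while the minimum keeps it attainable by the diagonal
      coupling.\<close>
    define r where "r = min (H \<pi>0 - 1) ((K + 1) / \<alpha>)"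
    have "r \<le> (K + 1) / \<alpha>" by (simp add: r_def)
    then have "K + 1 \<le> \<alpha> * r" using neg by (simp add: neg_le_divide_eq mult.commute)
    moreover have "\<alpha> * r \<le> K" by (rule zero) (simp add: r_def)
    ultimately show False by simp
  qed
  have w0: "w $ k \<le> 0" for k
  proof (rule ccontr)
    assume "\<not> w $ k \<le> 0"
    then have pos: "0 < w $ k" by simp
    \<comment> \<open>Raising the cost bound in direction \<open>k\<close> by this amount pushes the
      left side of \<open>sep\<close> to \<open>K + 1\<close>; the maximum with 0 keeps the point
      above the zero cost of the diagonal coupling.\<close>
    define t where "t = max 0 ((K + 1 - \<alpha> * (H \<pi>0 - 1)) / w $ k)"
    have "(H \<pi>0 - 1, axis k t) \<in> S"
      by (rule S_I[OF \<pi>0(1)]) (simp_all add: \<pi>0(2) axis_def t_def)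
    then have "\<alpha> * (H \<pi>0 - 1) + w $ k * t \<le> K"
      using sep by (fastforce simp: inner_axis)
    moreover have "(K + 1 - \<alpha> * (H \<pi>0 - 1)) / w $ k \<le> t" by (simp add: t_def)
    then have "K + 1 - \<alpha> * (H \<pi>0 - 1) \<le> w $ k * t" using pos by (simp add: pos_divide_le_eq mult.commute)
    ultimately show False by simp
  qed
  \<comment> \<open>Slater's condition at work: if \<open>\<alpha> = 0\<close>, the diagonal
    coupling gives \<open>0 \<le> w \<bullet> \<epsilon>\<close>, although all summands are
    nonpositive. Positivity of \<epsilon> then forces \<open>w = 0\<close>, so the normal vector
    would vanish.\<close>
  have \<alpha>: "0 < \<alpha>"
  proof (rule ccontr)
    assume "\<not> 0 < \<alpha>"
    then have a0: "\<alpha> = 0" using \<alpha>0 by simp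
    have "0 \<le> w \<bullet> \<epsilon>" using zero[of "H \<pi>0 - 1"] by (simp add: K_def a0)
    then have "0 \<le> (\<Sum>k\<in>UNIV. w $ k * \<epsilon> $ k)" by (simp add: inner_vec_def)
    moreover have np: "w $ k * \<epsilon> $ k \<le> 0" for k
      by (rule mult_nonpos_nonneg[OF w0 less_imp_le[OF eps]])
    ultimately have "(\<Sum>k\<in>UNIV. - (w $ k * \<epsilon> $ k)) = 0"
      using sum_nonpos[of UNIV "\<lambda>k. w $ k * \<epsilon> $ k"] by (simp add: sum_negf)
    then have "\<forall>k\<in>UNIV. - (w $ k * \<epsilon> $ k) = 0"
      using np by (subst (asm) sum_nonneg_eq_0_iff) simp_all
    then have "w $ k * \<epsilon> $ k = 0" for k by simp
    then have "w $ k = 0" for k using eps[of k] by (metis less_irrefl mult_eq_0_iff)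
    then have "w = 0" by (simp add: vec_eq_iff)
    with a0 n(1) nw show False by (simp add: zero_prod_def)
  qed
  \<comment> \<open>Dividing by \<open>\<alpha>\<close> gives the reward the coefficient 1; the sign
    turns the nonpositive \<open>w\<close> into a nonnegative multiplier.\<close>
  define l where "l = - (1 / \<alpha>) *\<^sub>R w"
  show thesis
  proof (rule that)
    show "0 \<le> l $ k" for k using w0[of k] \<alpha> by (simp add: l_def divide_nonpos_pos)
    fix \<pi> assume \<pi>: "\<pi> \<in> couplings_from Q" "integrable \<pi> (\<lambda>z. h (snd z))" "\<And>k. integrable \<pi> (\<lambda>z. c z $ k)"
    then have "adm \<pi>" by (simp add: adm_def)
    define u where "u = (\<chi> k. J \<pi> k)"
    have "r - l \<bullet> u \<le> v - l \<bullet> \<epsilon>" if "r < H \<pi>" for r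
    proof -
      have "\<alpha> * r + w \<bullet> u \<le> K" by (rule sep, rule S_I[OF \<open>adm \<pi>\<close> that]) (simp add: u_def)
      moreover have "w = - \<alpha> *\<^sub>R l" using \<alpha> by (simp add: l_def)
      ultimately have "\<alpha> * (r - l \<bullet> u) \<le> \<alpha> * (v - l \<bullet> \<epsilon>)" by (simp add: K_def algebra_simps)
      then show ?thesis using \<alpha> by simp
    qed
    \<comment> \<open>\<open>S\<close> contains only rewards strictly below \<open>H \<pi>\<close>;
      density of the reals extends the bound to \<open>H \<pi>\<close> itself.\<close>
    then have "r \<le> v - l \<bullet> \<epsilon> + l \<bullet> u" if "r < H \<pi>" for r using that by (fastforce simp: algebra_simps)
    then have "H \<pi> \<le> v - l \<bullet> \<epsilon> + l \<bullet> u" by (rule dense_le)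
    moreover have "l \<bullet> u = (\<Sum>k\<in>UNIV. l $ k * J \<pi> k)" by (simp add: inner_vec_def u_def)
    ultimately show "integral\<^sup>L \<pi> (\<lambda>z. h (snd z)) - (\<Sum>k\<in>UNIV. l $ k * integral\<^sup>L \<pi> (\<lambda>z. c z $ k)) \<le> v - l \<bullet> \<epsilon>"
      by (simp add: H_def J_def)
  qed
qed

section \<open>Weak duality\<close>

lemma coupling_measurable:
  assumes "\<pi> \<in> couplings_from Q"
  shows "sets \<pi> = sets borel" "prob_space \<pi>" "distr \<pi> borel fst = Q"
    "fst \<in> measurable \<pi> borel" "snd \<in> measurable \<pi> borel" "(\<lambda>z. c z $ k) \<in> borel_measurable \<pi>"
proof -
  show s: "sets \<pi> = sets borel" and "prob_space \<pi>" "distr \<pi> borel fst = Q"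
    using assms by (simp_all add: couplings_from_def borel_probs_def)
  show "fst \<in> measurable \<pi> borel" "snd \<in> measurable \<pi> borel" "(\<lambda>z. c z $ k) \<in> borel_measurable \<pi>"
    unfolding measurable_cong_sets[OF s refl] borel_prod[symmetric] by measurable
qed

lemma dual_feasible_measurable_completion:
  assumes "(l, \<phi>) \<in> dual_feasible h c"
  shows "\<phi> \<in> borel_measurable (completion Q)"
proof (rule measurableI)
  have m: "\<phi> \<in> borel_measurable univ_borel" using assms by (simp add: dual_feasible_def)
  fix A :: "ereal set" assume "A \<in> sets borel"
  then have "\<phi> -` A \<inter> space univ_borel \<in> sets univ_borel" by (rule measurable_sets[OF m])
  then have "\<phi> -` A \<in> sets (completion Q)"
    using Q by (simp add: sets_univ_borel)
  then show "\<phi> -` A \<inter> space (completion Q) \<in> sets (completion Q)" by simp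
qed simp

text \<open>The dual constraint is integrated against a coupling. Neither the reward nor the dual
  function need be integrable, so the inequality is carried through with separate positive and
  negative parts.\<close>

lemma weak_duality:
  assumes eps: "\<And>k. 0 < \<epsilon> $ k" and feas: "(l, \<phi>) \<in> dual_feasible h c"
    and P: "P \<in> transport_hyperrectangle c Q \<epsilon> \<inter> probs_quasi_int h"
  shows "ext_integral P (\<lambda>x. ereal (h x)) \<le> dual_objective Q \<epsilon> l \<phi>"
proof -
  have l: "0 \<le> l $ k" and \<phi>_ge: "ereal (h y - l \<bullet> c (x, y)) \<le> \<phi> x" for k x y
    using feas by (simp_all add: dual_feasible_def)
  have h_le: "ereal (h x) \<le> \<phi> x" for x
    using \<phi>_ge[of x x] payoff_diag[of l x] by (simp add: payoff_def)
  from P obtain \<pi> where \<pi>: "\<pi> \<in> couplings_from Q" "\<And>k. (\<integral>\<^sup>+z. ennreal (c z $ k) \<partial>\<pi>) \<le> ennreal (\<epsilon> $ k)"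
      and P_eq: "P = distr \<pi> borel snd"
    unfolding transport_hyperrectangle_def couplings_within_def by auto
  note s\<pi> = coupling_measurable(1)[OF \<pi>(1)] and d\<pi> = coupling_measurable(3)[OF \<pi>(1)]
  note [measurable] = coupling_measurable(4,5,6)[OF \<pi>(1)]
  have \<phi>_meas [measurable]: "\<phi> \<in> borel_measurable (completion Q)"
    by (rule dual_feasible_measurable_completion[OF feas])
  \<comment> \<open>\<open>\<phi>\<close> is measurable only for the completion of \<open>Q\<close>,
    and its composition with \<open>fst\<close> need not be measurable for \<open>\<pi>\<close>.
    Borel versions \<open>p\<close> and \<open>n\<close> of its two parts replace it in all
    integrals over \<open>\<pi>\<close>.\<close>
  have "(\<lambda>x. e2ennreal (\<phi> x)) \<in> borel_measurable (completion Q)" by measurable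
  from completion_ex_borel_measurable[OF this] obtain p
    where p [measurable]: "p \<in> borel_measurable Q" and p_ae: "AE x in Q. e2ennreal (\<phi> x) = p x" by (rule bexE)
  have "(\<lambda>x. e2ennreal (- \<phi> x)) \<in> borel_measurable (completion Q)" by measurable
  from completion_ex_borel_measurable[OF this] obtain n
    where n [measurable]: "n \<in> borel_measurable Q" and n_ae: "AE x in Q. e2ennreal (- \<phi> x) = n x" by (rule bexE)
  have pb [measurable]: "p \<in> borel_measurable borel" and nb [measurable]: "n \<in> borel_measurable borel"
    using p n by (simp_all only: measurable_cong_sets[OF sets_Q refl])
  have pQ: "(\<integral>\<^sup>+x. e2ennreal (\<phi> x) \<partial>completion Q) = (\<integral>\<^sup>+z. p (fst z) \<partial>\<pi>)"
  proof -
    have "(\<integral>\<^sup>+x. e2ennreal (\<phi> x) \<partial>completion Q) = (\<integral>\<^sup>+x. p x \<partial>Q)"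
      unfolding nn_integral_completion by (rule nn_integral_cong_AE[OF p_ae])
    also have "\<dots> = (\<integral>\<^sup>+z. p (fst z) \<partial>\<pi>)"
      unfolding d\<pi>[symmetric] by (rule nn_integral_distr) simp_all
    finally show ?thesis .
  qed
  have nQ: "(\<integral>\<^sup>+x. e2ennreal (- \<phi> x) \<partial>completion Q) = (\<integral>\<^sup>+z. n (fst z) \<partial>\<pi>)"
  proof -
    have "(\<integral>\<^sup>+x. e2ennreal (- \<phi> x) \<partial>completion Q) = (\<integral>\<^sup>+x. n x \<partial>Q)"
      unfolding nn_integral_completion by (rule nn_integral_cong_AE[OF n_ae])
    also have "\<dots> = (\<integral>\<^sup>+z. n (fst z) \<partial>\<pi>)"
      unfolding d\<pi>[symmetric] by (rule nn_integral_distr) simp_all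
    finally show ?thesis .
  qed
  have n_fin: "(\<integral>\<^sup>+z. n (fst z) \<partial>\<pi>) < \<infinity>"
  proof -
    have "(\<integral>\<^sup>+z. n (fst z) \<partial>\<pi>) = (\<integral>\<^sup>+x. e2ennreal (- \<phi> x) \<partial>Q)"
      unfolding nQ[symmetric] nn_integral_completion ..
    also have "\<dots> \<le> (\<integral>\<^sup>+x. ennreal (- h x) \<partial>Q)"
    proof (rule nn_integral_mono)
      fix x
      have "- \<phi> x \<le> ereal (- h x)" using h_le[of x] by (cases "\<phi> x") simp_all
      then have "e2ennreal (- \<phi> x) \<le> e2ennreal (ereal (- h x))" by (rule e2ennreal_mono)
      then show "e2ennreal (- \<phi> x) \<le> ennreal (- h x)" by simp
    qed
    also have "\<dots> < \<infinity>" using h_int by (simp add: real_integrable_def less_top)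
    finally show ?thesis .
  qed
  \<comment> \<open>The exceptional set is \<open>Q\<close>-null, and \<open>Q\<close> is the first
    marginal of \<open>\<pi>\<close>, so its preimage is negligible for
    \<open>\<pi>\<close>.\<close>
  have eq: "AE z in \<pi>. e2ennreal (\<phi> (fst z)) = p (fst z) \<and> e2ennreal (- \<phi> (fst z)) = n (fst z)"
  proof -
    have "AE x in distr \<pi> borel fst. e2ennreal (\<phi> x) = p x \<and> e2ennreal (- \<phi> x) = n x"
      unfolding d\<pi> using p_ae n_ae by eventually_elim simp
    then show ?thesis by (rule AE_distrD[rotated]) measurable
  qed
  have "AE z in \<pi>. ennreal (h (snd z)) + n (fst z) \<le>
      p (fst z) + (\<Sum>k\<in>UNIV. ennreal (l $ k) * ennreal (c z $ k)) + ennreal (- h (snd z))"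
    using eq
  proof eventually_elim
    fix z :: "'a \<times> 'a" assume z: "e2ennreal (\<phi> (fst z)) = p (fst z) \<and> e2ennreal (- \<phi> (fst z)) = n (fst z)"
    have "ereal (h (snd z) - l \<bullet> c z) \<le> \<phi> (fst z)" using \<phi>_ge[of "snd z" "fst z"] by simp
    moreover have "0 \<le> l \<bullet> c z"
      unfolding inner_vec_def by (intro sum_nonneg) (simp add: l c_nonneg)
    ultimately have "ennreal (h (snd z)) + e2ennreal (- \<phi> (fst z)) \<le>
        e2ennreal (\<phi> (fst z)) + ennreal (l \<bullet> c z) + ennreal (- h (snd z))"
      by (rule ennreal_slack_bound)
    moreover have "ennreal (l \<bullet> c z) = (\<Sum>k\<in>UNIV. ennreal (l $ k) * ennreal (c z $ k))"
      unfolding inner_vec_def inner_real_def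
      by (subst sum_ennreal[symmetric]) (simp_all add: l c_nonneg ennreal_mult)
    ultimately show "ennreal (h (snd z)) + n (fst z) \<le>
      p (fst z) + (\<Sum>k\<in>UNIV. ennreal (l $ k) * ennreal (c z $ k)) + ennreal (- h (snd z))"
      using z by simp
  qed
  then have "(\<integral>\<^sup>+z. ennreal (h (snd z)) + n (fst z) \<partial>\<pi>) \<le>
      (\<integral>\<^sup>+z. p (fst z) + (\<Sum>k\<in>UNIV. ennreal (l $ k) * ennreal (c z $ k)) + ennreal (- h (snd z)) \<partial>\<pi>)"
    by (rule nn_integral_mono_AE)
  also have "(\<integral>\<^sup>+z. ennreal (h (snd z)) + n (fst z) \<partial>\<pi>) =
      (\<integral>\<^sup>+z. ennreal (h (snd z)) \<partial>\<pi>) + (\<integral>\<^sup>+z. n (fst z) \<partial>\<pi>)"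
    by (rule nn_integral_add) measurable
  also have "(\<integral>\<^sup>+z. p (fst z) + (\<Sum>k\<in>UNIV. ennreal (l $ k) * ennreal (c z $ k)) + ennreal (- h (snd z)) \<partial>\<pi>) =
      (\<integral>\<^sup>+z. p (fst z) \<partial>\<pi>) + (\<Sum>k\<in>UNIV. ennreal (l $ k) * (\<integral>\<^sup>+z. ennreal (c z $ k) \<partial>\<pi>)) +
      (\<integral>\<^sup>+z. ennreal (- h (snd z)) \<partial>\<pi>)"
    by (simp add: nn_integral_add nn_integral_sum nn_integral_cmult)
  also have "\<dots> \<le> (\<integral>\<^sup>+z. p (fst z) \<partial>\<pi>) + ennreal (l \<bullet> \<epsilon>) + (\<integral>\<^sup>+z. ennreal (- h (snd z)) \<partial>\<pi>)"
  proof (intro add_mono order_refl)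
    have "(\<Sum>k\<in>UNIV. ennreal (l $ k) * (\<integral>\<^sup>+z. ennreal (c z $ k) \<partial>\<pi>)) \<le> (\<Sum>k\<in>UNIV. ennreal (l $ k) * ennreal (\<epsilon> $ k))"
      by (intro sum_mono mult_left_mono \<pi>(2)) simp
    also have "\<dots> = ennreal (l \<bullet> \<epsilon>)"
      unfolding inner_vec_def inner_real_def
      by (subst sum_ennreal[symmetric]) (simp_all add: l less_imp_le[OF eps] ennreal_mult)
    finally show "(\<Sum>k\<in>UNIV. ennreal (l $ k) * (\<integral>\<^sup>+z. ennreal (c z $ k) \<partial>\<pi>)) \<le> ennreal (l \<bullet> \<epsilon>)" .
  qed
  finally have main: "(\<integral>\<^sup>+z. ennreal (h (snd z)) \<partial>\<pi>) + (\<integral>\<^sup>+z. n (fst z) \<partial>\<pi>) \<le>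
      (\<integral>\<^sup>+z. p (fst z) \<partial>\<pi>) + ennreal (l \<bullet> \<epsilon>) + (\<integral>\<^sup>+z. ennreal (- h (snd z)) \<partial>\<pi>)" .
  have h\<pi>: "(\<integral>\<^sup>+x. ennreal (h x) \<partial>P) = (\<integral>\<^sup>+z. ennreal (h (snd z)) \<partial>\<pi>)"
    "(\<integral>\<^sup>+x. ennreal (- h x) \<partial>P) = (\<integral>\<^sup>+z. ennreal (- h (snd z)) \<partial>\<pi>)"
    unfolding P_eq by (rule nn_integral_distr; measurable)+
  have "ennreal (max a 0) = ennreal a" "- min a 0 = max (- a) 0" for a :: real
    by (auto simp: max_def ennreal_neg)
  then have "(\<integral>\<^sup>+x. ennreal (h x) \<partial>P) < \<infinity> \<or> (\<integral>\<^sup>+x. ennreal (- h x) \<partial>P) < \<infinity>"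
    using P unfolding probs_quasi_int_def by simp
  moreover have "0 \<le> l \<bullet> \<epsilon>"
    unfolding inner_vec_def by (intro sum_nonneg) (simp add: l less_imp_le[OF eps])
  ultimately have "enn2ereal (\<integral>\<^sup>+x. ennreal (h x) \<partial>P) - enn2ereal (\<integral>\<^sup>+x. ennreal (- h x) \<partial>P) \<le>
      ereal (l \<bullet> \<epsilon>) + (enn2ereal (\<integral>\<^sup>+z. p (fst z) \<partial>\<pi>) - enn2ereal (\<integral>\<^sup>+z. n (fst z) \<partial>\<pi>))"
    using main n_fin unfolding h\<pi> by (intro enn2ereal_diff_bound)
  then show ?thesis
    unfolding dual_objective_def ext_integral_def pQ nQ by simp
qed

section \<open>Dual attainment and strong duality\<close>

lemma primal_value_ge:
  assumes \<pi>: "\<pi> \<in> couplings_from Q" and hi: "integrable \<pi> (\<lambda>z. h (snd z))"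
    and ci: "\<And>k. integrable \<pi> (\<lambda>z. c z $ k)" and ce: "\<And>k. integral\<^sup>L \<pi> (\<lambda>z. c z $ k) \<le> \<epsilon> $ k"
  shows "ereal (integral\<^sup>L \<pi> (\<lambda>z. h (snd z))) \<le> primal_value h c Q \<epsilon>"
proof -
  note [measurable] = coupling_measurable(5)[OF \<pi>]
  define P where "P = distr \<pi> borel snd"
  have "(\<integral>\<^sup>+z. ennreal (c z $ k) \<partial>\<pi>) \<le> ennreal (\<epsilon> $ k)" for k
    by (subst nn_integral_eq_integral[OF ci]) (simp_all add: c_nonneg ennreal_leI ce)
  then have T: "P \<in> transport_hyperrectangle c Q \<epsilon>"
    unfolding transport_hyperrectangle_def couplings_within_def P_def using \<pi> by simp
  have Pi: "integrable P h" unfolding P_def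
    by (subst integrable_distr_eq) (simp_all add: hi)
  have "ennreal (max a 0) = ennreal a" for a :: real
    by (auto simp: max_def ennreal_neg)
  then have "P \<in> probs_quasi_int h"
    using Pi prob_space.prob_space_distr[OF coupling_measurable(2)[OF \<pi>] coupling_measurable(5)[OF \<pi>]]
    unfolding probs_quasi_int_def borel_probs_def real_integrable_def by (simp add: P_def less_top)
  with T have "ext_integral P (\<lambda>x. ereal (h x)) \<le> primal_value h c Q \<epsilon>"
    unfolding primal_value_def by (intro SUP_upper IntI)
  moreover have "integral\<^sup>L P h = integral\<^sup>L \<pi> (\<lambda>z. h (snd z))"
    unfolding P_def by (rule integral_distr) simp_all
  ultimately show ?thesis unfolding ext_integral_integrable[OF Pi] by simp
qed

lemma dual_potential_feasible:
  assumes l: "\<And>k. 0 \<le> l $ k"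
  shows "(l, dual_potential h c l) \<in> dual_feasible h c"
proof -
  have m: "dual_potential h c l \<in> borel_measurable univ_borel"
    by (rule dual_potential_measurable[OF usc_payoff[OF h_usc c_lsc l]])
  have ge: "ereal (payoff h c l (x, y)) \<le> dual_potential h c l x" for x y
    unfolding dual_potential_eq by (rule SUP_upper) simp
  have "dual_potential h c l x \<noteq> - \<infinity>" for x using ge[of x x] by auto
  with m ge l show ?thesis unfolding dual_feasible_def payoff_def by simp
qed

text \<open>The value -\<infinity> is excluded by the diagonal coupling. For a finite value, the
  multiplier inequality on graph couplings bounds every tame payoff integral by
  \<open>v - l \<bullet> \<epsilon>\<close>, and this bound passes to the integral of the
  potential.\<close>

lemma dual_attained:
  assumes eps: "\<And>k. 0 < \<epsilon> $ k"
  obtains l where "\<And>k. 0 \<le> l $ k"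
    "dual_objective Q \<epsilon> l (dual_potential h c l) \<le> primal_value h c Q \<epsilon>"
proof (cases "primal_value h c Q \<epsilon>")
  case PInf
  then show thesis by (intro that[of 0]) simp_all
next
  case MInf
  have "ereal (integral\<^sup>L (distr Q borel (\<lambda>x. (x, x))) (\<lambda>z. h (snd z))) \<le> primal_value h c Q \<epsilon>"
    using graph_coupling[OF tame_id] less_imp_le[OF eps]
    by (intro primal_value_ge) (simp_all add: c_diag)
  then show thesis unfolding MInf by simp
next
  case (real v)
  show thesis
  proof (rule multiplier_exists[of \<epsilon> v])
    show "0 < \<epsilon> $ k" for k by (rule eps)
  next
    fix \<pi> assume "\<pi> \<in> couplings_from Q" "integrable \<pi> (\<lambda>z. h (snd z))"
      "\<And>k. integrable \<pi> (\<lambda>z. c z $ k)" "\<And>k. integral\<^sup>L \<pi> (\<lambda>z. c z $ k) \<le> \<epsilon> $ k"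
    then have "ereal (integral\<^sup>L \<pi> (\<lambda>z. h (snd z))) \<le> primal_value h c Q \<epsilon>"
      by (rule primal_value_ge)
    then show "integral\<^sup>L \<pi> (\<lambda>z. h (snd z)) \<le> v" by (simp add: real)
  next
    fix l
    assume l: "\<And>k. 0 \<le> l $ k"
      and bd: "\<And>\<pi>. \<pi> \<in> couplings_from Q \<Longrightarrow> integrable \<pi> (\<lambda>z. h (snd z)) \<Longrightarrow>
        (\<And>k. integrable \<pi> (\<lambda>z. c z $ k)) \<Longrightarrow>
        integral\<^sup>L \<pi> (\<lambda>z. h (snd z)) - (\<Sum>k\<in>UNIV. l $ k * integral\<^sup>L \<pi> (\<lambda>z. c z $ k)) \<le> v - l \<bullet> \<epsilon>"
    have "(\<integral>x. payoff h c l (x, s x) \<partial>Q) \<le> v - l \<bullet> \<epsilon>" if s: "tame s" for s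
    proof -
      have "(\<integral>x. payoff h c l (x, s x) \<partial>Q) = (\<integral>x. h (s x) \<partial>Q) - (\<Sum>k\<in>UNIV. l $ k * (\<integral>x. c (x, s x) $ k \<partial>Q))"
        unfolding payoff_def inner_vec_def inner_real_def using s by (simp add: tame_def)
      also have "\<dots> \<le> v - l \<bullet> \<epsilon>"
        using bd[OF graph_coupling(1,2,3)[OF s]] unfolding graph_coupling(4,5)[OF s] .
      finally show ?thesis .
    qed
    then have "ext_integral (completion Q) (dual_potential h c l) \<le> ereal (v - l \<bullet> \<epsilon>)"
      by (rule integral_dual_potential_le[OF l])
    then have "dual_objective Q \<epsilon> l (dual_potential h c l) \<le> ereal (l \<bullet> \<epsilon>) + ereal (v - l \<bullet> \<epsilon>)"
      unfolding dual_objective_def by (rule add_left_mono)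
    then show thesis by (intro that[of l] l) (simp add: real)
  qed
qed

text \<open>Weak duality and feasibility of the potentials order the values as primal, dual, infimum
  over \<open>l\<close>, objective at the multiplier. Since \<open>dual_attained\<close> bounds the
  last by the first, all four coincide.\<close>

lemma strong_duality:
  assumes eps: "\<And>k. 0 < \<epsilon> $ k"
  shows "primal_value h c Q \<epsilon> = dual_value h c Q \<epsilon>
     \<and> dual_value h c Q \<epsilon> =
         (INF l \<in> {l. \<forall>k. 0 \<le> l $ k}.
            ereal (l \<bullet> \<epsilon>) + ext_integral (completion Q) (dual_potential h c l))
     \<and> (\<exists>l. (l, dual_potential h c l) \<in> dual_feasible h c \<and>
             dual_objective Q \<epsilon> l (dual_potential h c l) = dual_value h c Q \<epsilon>)"
proof (rule dual_attained[OF eps])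
  fix l :: "real ^ 'n"
  assume l: "\<And>k. 0 \<le> l $ k"
    and att: "dual_objective Q \<epsilon> l (dual_potential h c l) \<le> primal_value h c Q \<epsilon>"
  let ?I = "INF l \<in> {l. \<forall>k. 0 \<le> l $ k}.
    ereal (l \<bullet> \<epsilon>) + ext_integral (completion Q) (dual_potential h c l)"
  have dual_le: "dual_value h c Q \<epsilon> \<le> dual_objective Q \<epsilon> l' (dual_potential h c l')"
    if "\<forall>k. 0 \<le> l' $ k" for l'
    unfolding dual_value_def
    by (rule INF_lower2[OF dual_potential_feasible[of l']]) (use that in simp_all)
  have weak: "primal_value h c Q \<epsilon> \<le> dual_value h c Q \<epsilon>"
    unfolding primal_value_def dual_value_def
  proof (intro SUP_least INF_greatest)
    fix P x assume "P \<in> transport_hyperrectangle c Q \<epsilon> \<inter> probs_quasi_int h" "x \<in> dual_feasible h c"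
    then show "ext_integral P (\<lambda>x. ereal (h x)) \<le> (case x of (l, \<phi>) \<Rightarrow> dual_objective Q \<epsilon> l \<phi>)"
      by (cases x) (simp only: prod.case weak_duality[OF eps])
  qed
  have I_ge: "dual_value h c Q \<epsilon> \<le> ?I"
    by (rule INF_greatest) (use dual_le in \<open>simp add: dual_objective_def\<close>)
  have I_le: "?I \<le> dual_objective Q \<epsilon> l (dual_potential h c l)"
    unfolding dual_objective_def by (rule INF_lower) (simp add: l)
  have obj_ge: "dual_value h c Q \<epsilon> \<le> dual_objective Q \<epsilon> l (dual_potential h c l)"
    by (rule dual_le) (simp add: l)
  note obj_le = order_trans[OF att weak]
  show ?thesis
  proof (intro conjI exI)
    show "primal_value h c Q \<epsilon> = dual_value h c Q \<epsilon>"
      using weak order_trans[OF obj_ge att] by (rule antisym)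
    show "dual_value h c Q \<epsilon> = ?I"
      using I_ge order_trans[OF I_le obj_le] by (rule antisym)
    show "(l, dual_potential h c l) \<in> dual_feasible h c"
      by (rule dual_potential_feasible[OF l])
    show "dual_objective Q \<epsilon> l (dual_potential h c l) = dual_value h c Q \<epsilon>"
      using obj_le obj_ge by (rule antisym)
  qed
qed

end

theorem theorem6p4:
  fixes Q :: "'a::polish_space measure"
    and \<epsilon> :: "real ^ 'n"
    and h :: "'a \<Rightarrow> real"
    and c :: "'a \<times> 'a \<Rightarrow> real ^ 'n"
    and cm :: "nat \<Rightarrow> 'a \<times> 'a \<Rightarrow> real ^ 'n"
    and K :: "'a set"
  assumes Q: "Q \<in> borel_probs"
    and eps_pos: "\<And>k. 0 < \<epsilon> $ k"
    and h_usc: "usc h"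
    and h_int: "integrable Q h"
    and c_nonneg: "\<And>k z. 0 \<le> c z $ k"
    and c_lsc: "\<And>k. lsc (\<lambda>z. c z $ k)"
    and c_diag: "\<And>k \<zeta>. c (\<zeta>, \<zeta>) $ k = 0"
    and cm_nonneg: "\<And>k m z. 0 \<le> cm m z $ k"
    and cm_cont: "\<And>k m. continuous_on UNIV (\<lambda>z. cm m z $ k)"
    and cm_diag: "\<And>k m \<zeta>. cm m (\<zeta>, \<zeta>) $ k = 0"
    and cm_mono: "\<And>k z. incseq (\<lambda>m. cm m z $ k)"
    and cm_lim: "\<And>k z. (\<lambda>m. cm m z $ k) \<longlonglongrightarrow> c z $ k"
    and K_compact: "compact K"
    and cm_indep: "\<And>m. lin_indep_on (K \<times> K) (\<lambda>k z. cm m z $ k)"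
    and cm_span: "\<And>m. fun_span_on (K \<times> K) (\<lambda>k z. cm m z $ k) \<inter> cont_funs_const2 K
                        = {restrict (\<lambda>z. 0) (K \<times> K)}"
  shows "primal_value h c Q \<epsilon> = dual_value h c Q \<epsilon>
     \<and> dual_value h c Q \<epsilon> =
         (INF l \<in> {l. \<forall>k. 0 \<le> l $ k}.
            ereal (l \<bullet> \<epsilon>) + ext_integral (completion Q) (dual_potential h c l))
     \<and> (\<exists>l. (l, dual_potential h c l) \<in> dual_feasible h c \<and>
             dual_objective Q \<epsilon> l (dual_potential h c l) = dual_value h c Q \<epsilon>)"
proof -
  interpret transport_problem Q h c
    by (rule transport_problem.intro[OF Q h_usc h_int c_nonneg c_lsc c_diag])
  show ?thesis by (rule strong_duality[OF eps_pos])
qed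

end
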